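(* Let $X=(X(t))_{t\ge 0}$ be an almost surely nondecreasing and right-continuous stochastic process. Suppose that there exist a positive function $c$ with $\lim_{t\to\infty}c(t)=\infty$ and an almost surely continuous stochastic process $Z=(Z(u))_{u\ge 0}$ such that, as $t\to\infty$, $$\Big(\frac{X(ut)}{c(t)}\Big)_{u\ge 0}\ \Rightarrow\ (Z(u))_{u\ge 0}$$ weakly on $D$ with the $J_1$-topology. Let $X_j=X^{\ast(j)}$ for $j\ge 1$. Then, as $t\to\infty$, $$\Big(\Big(\frac{X_j(ut)}{(c(t))^j}\Big)_{u\ge 0}\Big)_{j\ge 1}\ \Rightarrow\ \big((Z^{\ast(j)}(u))_{u\ge 0}\big)_{j\ge 1}$$ weakly in the product $J_1$-topology on $D^{\mathbb N}$.
   Context: $D$ is the Skorokhod space of c\`adl\`ag functions defined on $[0,\infty)$, endowed with the $J_1$-topology, and $\Rightarrow$ denotes weak convergence in a function space. $D^{\mathbb N}$ carries the product topology. For a nondecreasing right-continuous function $g$ on $[0,\infty)$, the $j$-fold Lebesgue-Stieltjes convolution of $g$ with itself is defined by $g^{\ast(1)}=g$ and, for $j\ge 2$, $$g^{\ast(j)}(t)=\int_{[0,t]}g(t-y)\,{\rm d}g^{\ast(j-1)}(y)=\int_{[0,t]}g^{\ast(j-1)}(t-y)\,{\rm d}g(y),\quad t\ge 0.$$ Here integration with respect to ${\rm d}h$ is with respect to the measure on $[0,\infty)$ assigning mass $h(y)$ to $[0,y]$ for every $y\ge0$ (so there is an atom of mass $h(0)$ at $0$). For the stochastic processes $X$ and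 $Z$, the convolutions are taken pathwise (the limit $Z$ is almost surely nondecreasing, being a continuous weak limit of nondecreasing processes). *)

theory Defs
  imports "HOL-Probability.Probability"
begin

section \<open>The Skorokhod space \<open>D[0,\<infinity>)\<close> with the \<open>J\<^sub>1\<close>-topology\<close>

definition is_cadlag :: "(real \<Rightarrow> real) \<Rightarrow> bool" where
  "is_cadlag f \<longleftrightarrow>
     (\<forall>t\<ge>0. continuous (at_right t) f) \<and> (\<forall>t>0. \<exists>l. (f \<longlongrightarrow> l) (at_left t))"

text \<open>A function on \<open>[0,\<infinity>)\<close> is represented by its extension by 0 to the negative half-line.\<close>

typedef cadlag = "{f :: real \<Rightarrow> real. is_cadlag f \<and> (\<forall>t<0. f t = 0)}"
  morphisms cadlag_fun Abs_cadlag
  by (rule exI[of _ "\<lambda>_. 0"]) (auto simp: is_cadlag_def)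

text \<open>
  \<open>to_cadlag f\<close> is the element of \<open>D\<close> given by the values of \<open>f\<close> on \<open>[0,\<infinity>)\<close>. Paths of processes
  are only almost surely cadlag; the exceptional paths are sent to the zero function.
\<close>

definition to_cadlag :: "(real \<Rightarrow> real) \<Rightarrow> cadlag" where
  "to_cadlag f =
     (if is_cadlag f then Abs_cadlag (\<lambda>t. if t < 0 then 0 else f t) else Abs_cadlag (\<lambda>_. 0))"

text \<open>
  The metric is the one of Billingsley, \<^emph>\<open>Convergence of Probability Measures\<close>, Section 16:
  \<open>d(x, y) = \<Sum>\<^sub>m\<^sub>\<ge>\<^sub>1 2\<^sup>-\<^sup>m min(1, d\<^sub>m(g\<^sub>m x, g\<^sub>m y))\<close>, where \<open>d\<^sub>m\<close> is Skorokhod's \<open>J\<^sub>1\<close>-metric on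
  \<open>D[0,m]\<close> and the cutoff \<open>g\<^sub>m\<close> is 1 on \<open>[0,m-1]\<close>, 0 on \<open>[m,\<infinity>)\<close> and linear in between.
\<close>

definition time_changes :: "real \<Rightarrow> (real \<Rightarrow> real) set" where
  "time_changes T =
     {\<tau>. strict_mono_on {0..T} \<tau> \<and> continuous_on {0..T} \<tau> \<and> \<tau> ` {0..T} = {0..T}}"

definition J1_dist_on :: "real \<Rightarrow> (real \<Rightarrow> real) \<Rightarrow> (real \<Rightarrow> real) \<Rightarrow> real" where
  "J1_dist_on T x y =
     (INF \<tau>\<in>time_changes T.
        max (SUP t\<in>{0..T}. \<bar>\<tau> t - t\<bar>) (SUP t\<in>{0..T}. \<bar>x t - y (\<tau> t)\<bar>))"

definition cutoff :: "real \<Rightarrow> real \<Rightarrow> real" where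
  "cutoff m t = (if t \<le> m - 1 then 1 else if t \<le> m then m - t else 0)"

definition J1_dist :: "cadlag \<Rightarrow> cadlag \<Rightarrow> real" where
  "J1_dist x y =
     (\<Sum>k. let m = Suc k in
        (1 / 2) ^ m *
        min 1 (J1_dist_on (real m)
                 (\<lambda>t. cutoff (real m) t * cadlag_fun x t)
                 (\<lambda>t. cutoff (real m) t * cadlag_fun y t)))"

instantiation cadlag :: topological_space
begin

definition open_cadlag :: "cadlag set \<Rightarrow> bool" where
  "open_cadlag U \<longleftrightarrow> (\<forall>x\<in>U. \<exists>e>0. \<forall>y. J1_dist x y < e \<longrightarrow> y \<in> U)"

instance
proof
  show "open (UNIV :: cadlag set)"
    unfolding open_cadlag_def by (auto intro: exI[of _ 1])
next
  fix S T :: "cadlag set"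
  assume S: "open S" and T: "open T"
  show "open (S \<inter> T)"
    unfolding open_cadlag_def
  proof
    fix x assume x: "x \<in> S \<inter> T"
    obtain a where "a > 0" "\<forall>y. J1_dist x y < a \<longrightarrow> y \<in> S"
      using S x unfolding open_cadlag_def by blast
    moreover obtain b where "b > 0" "\<forall>y. J1_dist x y < b \<longrightarrow> y \<in> T"
      using T x unfolding open_cadlag_def by blast
    ultimately show "\<exists>e>0. \<forall>y. J1_dist x y < e \<longrightarrow> y \<in> S \<inter> T"
      by (intro exI[of _ "min a b"]) auto
  qed
next
  fix K :: "cadlag set set"
  assume "\<forall>S\<in>K. open S"
  then show "open (\<Union>K)"
    unfolding open_cadlag_def by (meson UnionE UnionI)
qed

end


section \<open>Weak convergence of random elements\<close>

text \<open>
  \<open>Y\<^sub>i \<Rightarrow> Y'\<close> along \<open>F\<close>, where the \<open>Y\<^sub>i\<close> live on \<open>M\<close> and \<open>Y'\<close> on \<open>N\<close>. The completions make random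
  elements that are specified only almost surely measurable whatever their values on the
  exceptional null set; they do not affect any expectation.
\<close>

definition converges_weakly ::
  "'a measure \<Rightarrow> ('i \<Rightarrow> 'a \<Rightarrow> 'c::topological_space) \<Rightarrow> 'b measure \<Rightarrow> ('b \<Rightarrow> 'c) \<Rightarrow> 'i filter \<Rightarrow> bool"
where
  "converges_weakly M Y N Y' F \<longleftrightarrow>
     (\<forall>\<^sub>F i in F. Y i \<in> borel_measurable (completion M)) \<and>
     Y' \<in> borel_measurable (completion N) \<and>
     (\<forall>f :: 'c \<Rightarrow> real. continuous_on UNIV f \<longrightarrow> bounded (range f) \<longrightarrow>
        ((\<lambda>i. \<integral>\<omega>. f (Y i \<omega>) \<partial>completion M) \<longlongrightarrow> (\<integral>\<omega>. f (Y' \<omega>) \<partial>completion N)) F)"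


section \<open>Lebesgue-Stieltjes convolution powers\<close>

text \<open>
  \<open>LS_integral f h t\<close> is the integral of \<open>f\<close> over \<open>[0,t]\<close> with respect to \<open>dh\<close>, for \<open>h\<close> nondecreasing
  and right-continuous on \<open>[0,\<infinity>)\<close>: the atom \<open>h(0)\<close> at 0 (possibly negative) is split off, and on
  \<open>(0,\<infinity>)\<close> the measure gives mass \<open>h(b) - h(a)\<close> to \<open>(a,b]\<close>.
\<close>

definition LS_integral :: "(real \<Rightarrow> real) \<Rightarrow> (real \<Rightarrow> real) \<Rightarrow> real \<Rightarrow> real" where
  "LS_integral f h t =
     f 0 * h 0 + (LINT y:{0<..t}|interval_measure (\<lambda>y. h (max 0 y)). f y)"

text \<open>
  \<open>LS_power j g\<close> is \<open>g\<^sup>*\<^sup>(\<^sup>j\<^sup>)\<close> for \<open>j \<ge> 1\<close>; the value at \<open>j = 0\<close> is the distribution function of the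
  unit mass at 0. Integrating against \<open>dg\<close> rather than \<open>dg\<^sup>*\<^sup>(\<^sup>j\<^sup>-\<^sup>1\<^sup>)\<close> only ever uses that \<open>g\<close> itself is
  nondecreasing, also when \<open>g(0) < 0\<close>.
\<close>

fun LS_power :: "nat \<Rightarrow> (real \<Rightarrow> real) \<Rightarrow> real \<Rightarrow> real" where
  "LS_power 0 g t = 1"
| "LS_power (Suc 0) g t = g t"
| "LS_power (Suc (Suc j)) g t = LS_integral (\<lambda>y. LS_power (Suc j) g (t - y)) g t"

end

theory Submission
  imports Defs
begin

text \<open>
  The theorem is a continuous mapping statement for the map that sends a nondecreasing path \<open>x\<close>
  to the sequence of its convolution powers \<open>x\<^sup>*\<^sup>(\<^sup>j\<^sup>)\<close>. Convolution powers commute with rescaling of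
  time and space (\<open>LS_power_scale\<close>), so the rescaled powers of \<open>X\<close> are the powers of the rescaled
  path of \<open>X\<close>, whose weak convergence is the hypothesis.
  
  The map is not \<open>J\<^sub>1\<close>-continuous everywhere: distinct jumps of the powers of \<open>x\<^sub>n\<close> may merge into one
  jump in the limit. It is continuous at continuous limits, which suffices because \<open>Z\<close> has almost
  surely continuous paths. Indeed \<open>J\<^sub>1\<close>-convergence to a continuous path is locally uniform
  (\<open>uniform_limit_of_cadlag_tendsto\<close>), locally uniform convergence of nondecreasing paths carries
  over to their convolution powers (\<open>uniform_limit_LS_power\<close>), and locally uniform convergence
  implies \<open>J\<^sub>1\<close>-convergence (\<open>cadlag_tendsto_of_uniform_limit\<close>). The middle step rests on Riemann
  sums: for continuous \<open>p\<close> the convolution of \<open>p\<close> with \<open>h\<close> differs from a finite sum in the increments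
  of \<open>h\<close> by at most the modulus of continuity of \<open>p\<close> times the mass of \<open>h\<close> (\<open>riemann_error\<close>), and
  finite sums are stable under uniform perturbation of \<open>h\<close>. That the paths of \<open>Z\<close> are almost surely
  nondecreasing follows because a weak limit stays in the closure of any set that carries the
  approximating random elements (\<open>converges_weakly_closure\<close>).
  
  Discontinuity of the map makes the measurability of the random sequence of powers a question of
  its own. It is reduced to the measurability of the values at fixed times: every cadlag path is the
  \<open>J\<^sub>1\<close>-limit of its discretisations on the grids of mesh \<open>1/n\<close> (\<open>grid_step_tendsto\<close>), and these are
  continuous functions of countably many real numbers. The values at fixed times are
  limits of Riemann sums, hence measurable (\<open>borel_measurable_LS_power\<close>).
  
  All of this takes place in a metric space, since \<open>J1_dist\<close> satisfies the metric axioms. The mapping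
  theorem itself (\<open>continuous_mapping\<close>) compares a bounded function that is continuous only at some
  points with its Lipschitz minorants.
\<close>

section \<open>Cadlag functions\<close>

lemma is_cadlag_cong:
  assumes "\<And>t. t \<ge> 0 \<Longrightarrow> f t = g t"
  shows "is_cadlag f \<longleftrightarrow> is_cadlag g"
proof -
  have "continuous (at_right t) f \<longleftrightarrow> continuous (at_right t) g" if "t \<ge> 0" for t
  proof -
    have "eventually (\<lambda>s. f s = g s) (at_right t)"
      using that assms by (auto simp: eventually_at_filter)
    then show ?thesis
      using that assms by (simp add: continuous_within tendsto_cong)
  qed
  moreover have "(f \<longlongrightarrow> l) (at_left t) \<longleftrightarrow> (g \<longlongrightarrow> l) (at_left t)" if "t > 0" for t l
  proof (rule tendsto_cong)
    show "eventually (\<lambda>s. f s = g s) (at_left t)"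
      using eventually_at_left_real[OF that] by eventually_elim (use assms in auto)
  qed
  ultimately show ?thesis
    unfolding is_cadlag_def by auto
qed

lemma to_cadlag_cong:
  assumes "\<And>t. t \<ge> 0 \<Longrightarrow> f t = g t"
  shows "to_cadlag f = to_cadlag g"
proof -
  have "(\<lambda>t. if t < 0 then 0 else f t) = (\<lambda>t. if t < 0 then 0 else g t)"
    using assms by auto
  then show ?thesis
    unfolding to_cadlag_def by (simp add: is_cadlag_cong[OF assms])
qed

lemma is_cadlag_cadlag_fun [simp]: "is_cadlag (cadlag_fun x)"
  and cadlag_fun_neg [simp]: "t < 0 \<Longrightarrow> cadlag_fun x t = 0"
  using cadlag_fun[of x] by auto

lemma cadlag_fun_to_cadlag:
  assumes "is_cadlag f"
  shows "cadlag_fun (to_cadlag f) t = (if t < 0 then 0 else f t)"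
proof -
  have "is_cadlag (\<lambda>t. if t < 0 then 0 else f t)"
    using assms by (subst is_cadlag_cong[where g = f]) auto
  then show ?thesis
    using assms by (simp add: to_cadlag_def Abs_cadlag_inverse)
qed

lemma is_cadlag_diff:
  "is_cadlag f \<Longrightarrow> is_cadlag g \<Longrightarrow> is_cadlag (\<lambda>t. f t - g t)"
  unfolding is_cadlag_def by (blast intro: continuous_diff tendsto_diff)

lemma is_cadlag_mono:
  assumes mono: "mono_on {0..} f" and cont: "\<And>t. t \<ge> 0 \<Longrightarrow> continuous (at_right t) f"
  shows "is_cadlag f"
  unfolding is_cadlag_def
proof (intro conjI allI impI)
  fix t :: real assume "t > 0"
  have "(f \<longlongrightarrow> Sup (f ` ({..<t} \<inter> {0<..}))) (at t within ({..<t} \<inter> {0<..}))"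
    using \<open>t > 0\<close> mono
    by (intro Lim_left_bound[where K = "f t"]) (auto simp: mono_on_def)
  moreover have "at t within ({..<t} \<inter> {0<..}) = at_left t"
    using \<open>t > 0\<close> by (intro at_within_nhd[where S = "{0<..}"]) auto
  ultimately show "\<exists>l. (f \<longlongrightarrow> l) (at_left t)"
    by auto
qed (use cont in auto)

lemma is_cadlag_left_limit: "is_cadlag f \<Longrightarrow> t > 0 \<Longrightarrow> \<exists>l. (f \<longlongrightarrow> l) (at_left t)"
  and is_cadlag_right_limit: "is_cadlag f \<Longrightarrow> t \<ge> 0 \<Longrightarrow> (f \<longlongrightarrow> f t) (at_right t)"
  by (auto simp: is_cadlag_def continuous_within)

text \<open>
  The oscillation bounds are phrased for intervals \<open>[a, x)\<close> and \<open>[x, x + d)\<close>, with the value at the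
  left end point as reference, so that they can serve as the local step of a bisection argument:
  every interval around \<open>x\<close> splits at \<open>x\<close> into two pieces on which \<open>f\<close> is almost constant.
\<close>

lemma cadlag_local_oscillation:
  assumes f: "is_cadlag f" and "e > 0" and "x \<ge> 0"
  obtains d where "d > 0"
    and "\<And>a s. 0 \<le> a \<Longrightarrow> x - d < a \<Longrightarrow> a < x \<Longrightarrow> a \<le> s \<Longrightarrow> s < x \<Longrightarrow> \<bar>f s - f a\<bar> < e"
    and "\<And>s. x \<le> s \<Longrightarrow> s < x + d \<Longrightarrow> \<bar>f s - f x\<bar> < e"
proof -
  obtain d1 where d1: "d1 > 0" "\<And>s. x < s \<Longrightarrow> s < x + d1 \<Longrightarrow> \<bar>f s - f x\<bar> < e"
  proof -
    have "(f \<longlongrightarrow> f x) (at_right x)"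
      using f \<open>x \<ge> 0\<close> by (auto simp: is_cadlag_def continuous_within)
    then have "eventually (\<lambda>s. dist (f s) (f x) < e) (at_right x)"
      using \<open>e > 0\<close> by (rule tendstoD)
    then obtain b where "b > x" "\<And>s. x < s \<Longrightarrow> s < b \<Longrightarrow> dist (f s) (f x) < e"
      by (auto simp: eventually_at_right_field)
    then show ?thesis by (intro that[of "b - x"]) (auto simp: dist_real_def)
  qed
  obtain d2 where d2: "d2 > 0"
    "\<And>a s. 0 \<le> a \<Longrightarrow> x - d2 < a \<Longrightarrow> a < x \<Longrightarrow> a \<le> s \<Longrightarrow> s < x \<Longrightarrow> \<bar>f s - f a\<bar> < e"
  proof (cases "x = 0")
    case True
    then show ?thesis by (intro that[of 1]) auto
  next
    case False
    then obtain l where "(f \<longlongrightarrow> l) (at_left x)"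
      using is_cadlag_left_limit[OF f, of x] \<open>x \<ge> 0\<close> by auto
    then have "eventually (\<lambda>s. dist (f s) l < e / 2) (at_left x)"
      using \<open>e > 0\<close> by (intro tendstoD) auto
    then obtain b where b: "b < x" "\<And>s. b < s \<Longrightarrow> s < x \<Longrightarrow> \<bar>f s - l\<bar> < e / 2"
      by (auto simp: eventually_at_left_field dist_real_def)
    show ?thesis
    proof (rule that[of "x - b"])
      fix a s assume "x - (x - b) < a" "a < x" "a \<le> s" "s < x"
      then show "\<bar>f s - f a\<bar> < e" using b(2)[of s] b(2)[of a] by linarith
    qed (use b in auto)
  qed
  show ?thesis
  proof (rule that[of "min d1 d2"])
    fix s assume "x \<le> s" "s < x + min d1 d2"
    then show "\<bar>f s - f x\<bar> < e"
      using d1(2)[of s] \<open>e > 0\<close> by (cases "s = x") auto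
  qed (use d1 d2 in auto)
qed

lemma cadlag_bounded:
  assumes f: "is_cadlag f"
  obtains K where "K \<ge> 0" and "\<And>t. 0 \<le> t \<Longrightarrow> t \<le> T \<Longrightarrow> \<bar>f t\<bar> \<le> K"
proof (cases "T \<ge> 0")
  case True
  define P where "P a b \<longleftrightarrow> (0 \<le> a \<longrightarrow> (\<exists>K. \<forall>t. a \<le> t \<and> t \<le> b \<longrightarrow> \<bar>f t\<bar> \<le> K))" for a b
  have "P 0 T"
    using True
  proof (induction rule: Bolzano)
    case (trans a b c)
    show ?case unfolding P_def
    proof
      assume "0 \<le> a"
      with trans obtain K L where "\<forall>t. a \<le> t \<and> t \<le> b \<longrightarrow> \<bar>f t\<bar> \<le> K"
        "\<forall>t. b \<le> t \<and> t \<le> c \<longrightarrow> \<bar>f t\<bar> \<le> L"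
        unfolding P_def by auto
      then have "\<forall>t. a \<le> t \<and> t \<le> c \<longrightarrow> \<bar>f t\<bar> \<le> max K L"
        by (metis le_cases max.coboundedI1 max.coboundedI2)
      then show "\<exists>K. \<forall>t. a \<le> t \<and> t \<le> c \<longrightarrow> \<bar>f t\<bar> \<le> K" ..
    qed
  next
    case (local x)
    obtain d where d: "d > 0"
      "\<And>a s. 0 \<le> a \<Longrightarrow> x - d < a \<Longrightarrow> a < x \<Longrightarrow> a \<le> s \<Longrightarrow> s < x \<Longrightarrow> \<bar>f s - f a\<bar> < 1"
      "\<And>s. x \<le> s \<Longrightarrow> s < x + d \<Longrightarrow> \<bar>f s - f x\<bar> < 1"
      using cadlag_local_oscillation[OF f, of 1 x] local by auto
    have "\<bar>f t\<bar> \<le> \<bar>f a\<bar> + \<bar>f x\<bar> + 1"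
      if "a \<le> x" "x \<le> b" "b - a < d" "0 \<le> a" "a \<le> t" "t \<le> b" for a b t
      using d(2)[of a t] d(3)[of t] that by (cases "t < x") force+
    then show ?case unfolding P_def using d(1) by blast
  qed
  then obtain K where "\<forall>t. 0 \<le> t \<and> t \<le> T \<longrightarrow> \<bar>f t\<bar> \<le> K" by (auto simp: P_def)
  then show ?thesis using True
    by (intro that[of K]) (auto intro: order_trans[OF abs_ge_zero])
qed (auto intro: that[of 0])

lemma floor_approx_right:
  fixes t :: real
  shows "(\<lambda>n. (real_of_int \<lfloor>t * real (Suc n)\<rfloor> + 1) / real (Suc n)) \<longlonglongrightarrow> t"
    and "t < (real_of_int \<lfloor>t * real (Suc n)\<rfloor> + 1) / real (Suc n)"
proof -
  show less: "t < (real_of_int \<lfloor>t * real (Suc n)\<rfloor> + 1) / real (Suc n)" for n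
    by (subst pos_less_divide_eq) linarith+
  have le: "(real_of_int \<lfloor>t * real (Suc n)\<rfloor> + 1) / real (Suc n) \<le> t + 1 / real (Suc n)" for n
  proof -
    have "(real_of_int \<lfloor>t * real (Suc n)\<rfloor> + 1) / real (Suc n) \<le> (t * real (Suc n) + 1) / real (Suc n)"
      by (intro divide_right_mono) auto
    also have "\<dots> = t + 1 / real (Suc n)" by (simp add: field_simps)
    finally show ?thesis .
  qed
  have "(\<lambda>n. t + 1 / real (Suc n)) \<longlonglongrightarrow> t + 0"
    by (intro tendsto_intros LIMSEQ_Suc[OF lim_1_over_n])
  then have lim: "(\<lambda>n. t + 1 / real (Suc n)) \<longlonglongrightarrow> t" by simp
  show "(\<lambda>n. (real_of_int \<lfloor>t * real (Suc n)\<rfloor> + 1) / real (Suc n)) \<longlonglongrightarrow> t"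
    by (rule tendsto_sandwich[OF always_eventually always_eventually tendsto_const lim])
      (use less le in \<open>auto intro: less_imp_le\<close>)
qed

text \<open>
  Evaluating \<open>f\<close> at the first point of the grid of mesh \<open>1/(n+1)\<close> strictly to the right of the
  argument gives functions of an integer variable, and right continuity makes them converge to \<open>f\<close>.
\<close>

lemma right_continuous_borel_measurable:
  fixes f :: "real \<Rightarrow> real"
  assumes "\<And>t. (f \<longlongrightarrow> f t) (at_right t)"
  shows "f \<in> borel_measurable borel"
proof (rule borel_measurable_LIMSEQ_real)
  fix t
  have "filterlim (\<lambda>n. (real_of_int \<lfloor>t * real (Suc n)\<rfloor> + 1) / real (Suc n)) (at_right t) sequentially"
    unfolding filterlim_at using floor_approx_right[of t]
    by (auto intro!: always_eventually simp del: of_nat_Suc simp: less_imp_neq[symmetric])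
  with assms show "(\<lambda>n. f ((real_of_int \<lfloor>t * real (Suc n)\<rfloor> + 1) / real (Suc n))) \<longlonglongrightarrow> f t"
    by (rule filterlim_compose)
next
  fix n
  have "(\<lambda>k::int. f ((real_of_int k + 1) / real (Suc n))) \<circ> (\<lambda>t. \<lfloor>t * real (Suc n)\<rfloor>) \<in> borel_measurable borel"
    by (rule measurable_comp[where N = "count_space UNIV"]) auto
  then show "(\<lambda>t. f ((real_of_int \<lfloor>t * real (Suc n)\<rfloor> + 1) / real (Suc n))) \<in> borel_measurable borel"
    by (simp add: o_def)
qed

text \<open>
  With the extension by zero, \<open>y \<mapsto> p (t - y)\<close> makes sense beyond \<open>t\<close>, and integrals over \<open>(0,t]\<close>
  become integrals over one fixed interval \<open>(0,T]\<close>, as dominated convergence in \<open>t\<close> requires.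
\<close>

definition zero_ext :: "(real \<Rightarrow> real) \<Rightarrow> real \<Rightarrow> real" where
  "zero_ext p u = (if u < 0 then 0 else p u)"

lemma cadlag_zero_ext:
  assumes p: "is_cadlag p"
  shows "(zero_ext p \<longlongrightarrow> zero_ext p t) (at_right t)" and "\<exists>l. (zero_ext p \<longlongrightarrow> l) (at_left t)"
    and "zero_ext p \<in> borel_measurable borel"
proof -
  show right: "(zero_ext p \<longlongrightarrow> zero_ext p t) (at_right t)" for t
  proof (cases "t < 0")
    case True
    then have "eventually (\<lambda>u. u < 0) (at_right t)"
      using order_tendstoD(2)[OF tendsto_ident_at] by blast
    then have "eventually (\<lambda>u. zero_ext p u = zero_ext p t) (at_right t)"
      by eventually_elim (use True in \<open>auto simp: zero_ext_def\<close>)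
    then show ?thesis by (rule tendsto_eventually)
  next
    case False
    then have "(p \<longlongrightarrow> p t) (at_right t)"
      using is_cadlag_right_limit[OF p] by auto
    moreover have "eventually (\<lambda>u. p u = zero_ext p u) (at_right t)"
      using False by (auto simp: zero_ext_def eventually_at_filter)
    moreover have "zero_ext p t = p t" using False by (simp add: zero_ext_def)
    ultimately show ?thesis by (simp add: tendsto_cong)
  qed
  show "\<exists>l. (zero_ext p \<longlongrightarrow> l) (at_left t)"
  proof (cases "t \<le> 0")
    case True
    then have "eventually (\<lambda>u. zero_ext p u = 0) (at_left t)"
      by (auto simp: zero_ext_def eventually_at_filter)
    then show ?thesis using tendsto_eventually by blast
  next
    case False
    then obtain l where "(p \<longlongrightarrow> l) (at_left t)"
      using is_cadlag_left_limit[OF p, of t] by auto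
    moreover have "eventually (\<lambda>u. p u = zero_ext p u) (at_left t)"
      using eventually_at_left_real[of 0 t] False by (auto simp: zero_ext_def elim!: eventually_mono)
    ultimately show ?thesis by (auto simp: tendsto_cong)
  qed
  show "zero_ext p \<in> borel_measurable borel"
    by (rule right_continuous_borel_measurable[OF right])
qed

section \<open>Lebesgue-Stieltjes convolution\<close>

definition mono_rc :: "(real \<Rightarrow> real) \<Rightarrow> bool" where
  "mono_rc h \<longleftrightarrow> mono_on {0..} h \<and> (\<forall>t\<ge>0. continuous (at_right t) h)"

abbreviation stieltjes :: "(real \<Rightarrow> real) \<Rightarrow> real measure" where
  "stieltjes h \<equiv> interval_measure (\<lambda>y. h (max 0 y))"

definition LS_conv :: "(real \<Rightarrow> real) \<Rightarrow> (real \<Rightarrow> real) \<Rightarrow> real \<Rightarrow> real" where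
  "LS_conv p h t = LS_integral (\<lambda>y. p (t - y)) h t"

lemma mono_rc_le: "mono_rc h \<Longrightarrow> 0 \<le> a \<Longrightarrow> a \<le> b \<Longrightarrow> h a \<le> h b"
  by (auto simp: mono_rc_def mono_on_def)

lemma mono_rc_is_cadlag: "mono_rc h \<Longrightarrow> is_cadlag h"
  by (auto simp: mono_rc_def intro: is_cadlag_mono)

lemma mono_rc_extend:
  assumes "mono_rc h"
  shows "x \<le> y \<Longrightarrow> h (max 0 x) \<le> h (max 0 y)"
    and "continuous (at_right a) (\<lambda>y. h (max 0 y))"
proof -
  show "x \<le> y \<Longrightarrow> h (max 0 x) \<le> h (max 0 y)"
    by (intro mono_rc_le[OF assms]) auto
  show "continuous (at_right a) (\<lambda>y. h (max 0 y))"
  proof (cases "a < 0")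
    case True
    then have "eventually (\<lambda>y. y < 0) (at_right a)"
      using order_tendstoD(2)[OF tendsto_ident_at] by blast
    then have "eventually (\<lambda>y. h (max 0 y) = h (max 0 a)) (at_right a)"
      by eventually_elim (use True in auto)
    then show ?thesis unfolding continuous_within by (rule tendsto_eventually)
  next
    case False
    then have "(h \<longlongrightarrow> h (max 0 a)) (at_right a)"
      using assms by (auto simp: mono_rc_def continuous_within max_def)
    moreover have "eventually (\<lambda>y. h y = h (max 0 y)) (at_right a)"
      using False by (auto simp: eventually_at_filter)
    ultimately show ?thesis
      unfolding continuous_within by (simp add: tendsto_cong)
  qed
qed

lemma stieltjes_Ioc:
  assumes "mono_rc h" "0 \<le> a" "a \<le> b"
  shows "emeasure (stieltjes h) {a<..b} = ennreal (h b - h a)"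
    and "measure (stieltjes h) {a<..b} = h b - h a"
  using emeasure_interval_measure_Ioc[of a b "\<lambda>y. h (max 0 y)"]
    measure_interval_measure_Ioc[of a b "\<lambda>y. h (max 0 y)"] mono_rc_extend[OF assms(1)] assms(2,3)
  by (auto simp: max_def split: if_splits)

lemma stieltjes_singleton_null:
  assumes "mono_rc h" "continuous_on {0..} h"
  shows "AE y in stieltjes h. y \<noteq> t"
proof -
  have "continuous_on UNIV (\<lambda>y. h (max 0 y))"
    by (rule continuous_on_compose2[OF assms(2)]) (auto intro!: continuous_intros)
  then have "emeasure (stieltjes h) {t..t} = 0"
    by (subst emeasure_interval_measure_Icc)
      (use mono_rc_extend[OF assms(1)] in auto)
  then show ?thesis
    by (intro AE_I[where N = "{t}"]) auto
qed

lemma integrable_indicator_mult_bounded: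
  fixes f :: "'a \<Rightarrow> real"
  assumes "A \<in> sets M" "emeasure M A < \<infinity>" "f \<in> borel_measurable M"
    and "\<And>x. x \<in> A \<Longrightarrow> \<bar>f x\<bar> \<le> K"
  shows "integrable M (\<lambda>x. indicator A x * f x)"
    and "\<bar>\<integral>x. indicator A x * f x \<partial>M\<bar> \<le> K * measure M A"
proof -
  have int: "integrable M (\<lambda>x. K * indicator A x)"
    using assms by (intro integrable_mult_right integrable_real_indicator)
  have le: "\<bar>indicator A x * f x\<bar> \<le> K * indicator A x" for x
    using assms(4) by (auto simp: indicator_def)
  show int': "integrable M (\<lambda>x. indicator A x * f x)"
    by (rule Bochner_Integration.integrable_bound[OF int])
      (use assms le in \<open>auto intro!: always_eventually order_trans[OF le abs_ge_self]\<close>)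
  have "\<bar>\<integral>x. indicator A x * f x \<partial>M\<bar> \<le> (\<integral>x. \<bar>indicator A x * f x\<bar> \<partial>M)"
    by (rule integral_abs_bound)
  also have "\<dots> \<le> (\<integral>x. K * indicator A x \<partial>M)"
    by (intro integral_mono int' int integrable_abs le)
  also have "\<dots> = K * measure M A"
    using assms(1) sets.sets_into_space[OF assms(1)] by (simp add: Int_absorb2)
  finally show "\<bar>\<integral>x. indicator A x * f x \<partial>M\<bar> \<le> K * measure M A" .
qed

lemma LS_conv_eq:
  assumes "0 \<le> t" "t \<le> T"
  shows "LS_conv p h t = p t * h 0 + (\<integral>y. indicator {0<..T} y * zero_ext p (t - y) \<partial>stieltjes h)"
proof -
  have "indicator {0<..t} y * p (t - y) = indicator {0<..T} y * zero_ext p (t - y)" for y :: real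
    using assms by (auto simp: indicator_def zero_ext_def)
  then show ?thesis
    by (simp add: LS_conv_def LS_integral_def set_lebesgue_integral_def)
qed

lemma zero_ext_bounded:
  assumes "\<And>t. 0 \<le> t \<Longrightarrow> t \<le> T \<Longrightarrow> \<bar>p t\<bar> \<le> K" "K \<ge> 0" "u \<le> T"
  shows "\<bar>zero_ext p u\<bar> \<le> K"
  using assms by (auto simp: zero_ext_def)

text \<open>
  Dominated convergence. Right continuity, left limits and continuity of a convolution are obtained
  from it by different choices of the sequence \<open>S\<close> and of the limiting integrand \<open>l\<close>.
\<close>

lemma LS_conv_sequential_limit:
  assumes p: "is_cadlag p" and h: "mono_rc h"
    and S: "\<And>n. S n \<le> T" "\<And>n. 0 \<le> S n" and "T \<ge> 0"
    and l: "l \<in> borel_measurable borel"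
    and lim: "AE y in stieltjes h. (\<lambda>n. zero_ext p (S n - y)) \<longlonglongrightarrow> l y"
    and p0: "(\<lambda>n. p (S n)) \<longlonglongrightarrow> a"
  shows "(\<lambda>n. LS_conv p h (S n)) \<longlonglongrightarrow> a * h 0 + (\<integral>y. indicator {0<..T} y * l y \<partial>stieltjes h)"
proof -
  obtain K where K: "K \<ge> 0" "\<And>t. 0 \<le> t \<Longrightarrow> t \<le> T \<Longrightarrow> \<bar>p t\<bar> \<le> K"
    using cadlag_bounded[OF p] by metis
  note [measurable] = cadlag_zero_ext(3)[OF p] l
  have "(\<lambda>n. \<integral>y. indicator {0<..T} y * zero_ext p (S n - y) \<partial>stieltjes h)
      \<longlonglongrightarrow> (\<integral>y. indicator {0<..T} y * l y \<partial>stieltjes h)"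
  proof (rule integral_dominated_convergence[where w = "\<lambda>y. K * indicator {0<..T} y"])
    show "integrable (stieltjes h) (\<lambda>y. K * indicator {0<..T} y)"
      using stieltjes_Ioc(1)[OF h, of 0 T] \<open>T \<ge> 0\<close>
      by (intro integrable_mult_right integrable_real_indicator) auto
    show "AE y in stieltjes h. (\<lambda>n. indicator {0<..T} y * zero_ext p (S n - y)) \<longlonglongrightarrow> indicator {0<..T} y * l y"
      using lim by eventually_elim (auto intro: tendsto_intros)
    fix n
    show "AE y in stieltjes h. norm (indicator {0<..T} y * zero_ext p (S n - y)) \<le> K * indicator {0<..T} y"
    proof (intro always_eventually allI)
      fix y
      show "norm (indicator {0<..T} y * zero_ext p (S n - y)) \<le> K * indicator {0<..T} y"
        using zero_ext_bounded[where p = p and T = T, OF K(2) K(1), of "S n - y"] S(1)[of n] by (auto simp: indicator_def)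
    qed
  qed simp_all
  then show ?thesis
    by (simp add: LS_conv_eq[OF S(2) S(1)] tendsto_add tendsto_mult p0)
qed

text \<open>
  Along \<open>S\<^sub>n \<down> t\<close> the integrand converges to its value at \<open>t\<close> and the integral is right-continuous.
  Along \<open>S\<^sub>n \<up> t\<close> it converges to the function of left limits of the zero extension; this function vanishes
  at \<open>y = t\<close>, so that an atom of \<open>h\<close> at \<open>t\<close> does not enter the left limit.
\<close>

lemma is_cadlag_LS_conv:
  assumes p: "is_cadlag p" and h: "mono_rc h"
  shows "is_cadlag (LS_conv p h)"
  unfolding is_cadlag_def
proof (intro conjI allI impI)
  note [measurable] = cadlag_zero_ext(3)[OF p]
  fix t :: real
  assume t: "t \<ge> 0"
  have "(LS_conv p h \<longlongrightarrow> LS_conv p h t) (at_right t)"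
  proof (rule tendsto_at_right_sequentially[where b = "t + 1"])
    fix S :: "nat \<Rightarrow> real"
    assume S: "\<And>n. t < S n" "\<And>n. S n < t + 1" "S \<longlonglongrightarrow> t"
    have right: "filterlim (\<lambda>n. S n - y) (at_right (t - y)) sequentially" for y
      unfolding filterlim_at using S by (auto intro!: always_eventually tendsto_intros simp: less_imp_neq[symmetric])
    have "(\<lambda>n. zero_ext p (S n - y)) \<longlonglongrightarrow> zero_ext p (t - y)" for y
      by (rule filterlim_compose[OF cadlag_zero_ext(1)[OF p] right])
    moreover have "(\<lambda>n. p (S n)) \<longlonglongrightarrow> p t"
      using filterlim_compose[OF is_cadlag_right_limit[OF p t], of S sequentially] right[of 0] by simp
    ultimately have "(\<lambda>n. LS_conv p h (S n)) \<longlonglongrightarrow>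
        p t * h 0 + (\<integral>y. indicator {0<..t + 1} y * zero_ext p (t - y) \<partial>stieltjes h)"
      using t S(2) less_trans[OF _ S(1), of 0]
      by (intro LS_conv_sequential_limit p h) (auto simp: less_imp_le order_trans[OF t less_imp_le[OF S(1)]])
    then show "(\<lambda>n. LS_conv p h (S n)) \<longlonglongrightarrow> LS_conv p h t"
      using t by (simp add: LS_conv_eq[where T = "t + 1"])
  qed auto
  then show "continuous (at_right t) (LS_conv p h)"
    by (simp add: continuous_within)
next
  note [measurable] = cadlag_zero_ext(3)[OF p]
  fix t :: real
  assume t: "t > 0"
  obtain l0 where l0: "(p \<longlongrightarrow> l0) (at_left t)"
    using is_cadlag_left_limit[OF p t] by auto
  define l where "l u = (SOME a. (zero_ext p \<longlongrightarrow> a) (at_left u))" for u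
  have l: "(zero_ext p \<longlongrightarrow> l u) (at_left u)" for u
    unfolding l_def by (rule someI_ex[OF cadlag_zero_ext(2)[OF p]])
  have "(LS_conv p h \<longlongrightarrow> l0 * h 0 + (\<integral>y. indicator {0<..t} y * l (t - y) \<partial>stieltjes h)) (at_left t)"
  proof (rule tendsto_at_left_sequentially[where b = 0])
    fix S :: "nat \<Rightarrow> real"
    assume S: "\<And>n. S n < t" "\<And>n. 0 < S n" "S \<longlonglongrightarrow> t"
    have left: "filterlim (\<lambda>n. S n - y) (at_left (t - y)) sequentially" for y
      unfolding filterlim_at using S by (auto intro!: always_eventually tendsto_intros simp: less_imp_neq)
    have lim: "(\<lambda>n. zero_ext p (S n - y)) \<longlonglongrightarrow> l (t - y)" for y
      by (rule filterlim_compose[OF l left])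
    moreover have "(\<lambda>n. p (S n)) \<longlonglongrightarrow> l0"
      using filterlim_compose[OF l0, of S sequentially] left[of 0] by simp
    moreover have "(\<lambda>y. l (t - y)) \<in> borel_measurable borel"
      by (rule borel_measurable_LIMSEQ_real[OF lim]) measurable
    ultimately show "(\<lambda>n. LS_conv p h (S n)) \<longlonglongrightarrow>
        l0 * h 0 + (\<integral>y. indicator {0<..t} y * l (t - y) \<partial>stieltjes h)"
      using t S(1,2) by (intro LS_conv_sequential_limit p h) (auto simp: less_imp_le)
  qed (use t in auto)
  then show "\<exists>l. (LS_conv p h \<longlongrightarrow> l) (at_left t)" ..
qed

text \<open>
  The zero extension of a continuous \<open>p\<close> jumps only at 0, that is, the integrand can fail to converge
  only at \<open>y = t\<close>; this point is a null set because \<open>h\<close> is continuous.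
\<close>

lemma continuous_LS_conv:
  assumes p: "is_cadlag p" "continuous_on {0..} p" and h: "mono_rc h" "continuous_on {0..} h"
  shows "continuous_on {0..} (LS_conv p h)"
  unfolding continuous_on_sequentially
proof (intro allI ballI impI)
  note [measurable] = cadlag_zero_ext(3)[OF p(1)]
  fix S :: "nat \<Rightarrow> real" and t
  assume "t \<in> {0..}" and "(\<forall>n. S n \<in> {0..}) \<and> S \<longlonglongrightarrow> t"
  then have t: "t \<ge> 0" and S: "\<And>n. S n \<ge> 0" "S \<longlonglongrightarrow> t" by auto
  obtain T where T: "\<And>n. S n \<le> T"
    using convergent_imp_Bseq[OF convergentI[OF S(2)]] unfolding Bseq_def
    by (fastforce dest: abs_le_D1)
  have tT: "t \<le> T" by (rule LIMSEQ_le_const2[OF S(2)]) (use T in auto)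
  have "AE y in stieltjes h. (\<lambda>n. zero_ext p (S n - y)) \<longlonglongrightarrow> zero_ext p (t - y)"
    using stieltjes_singleton_null[OF h, of t]
  proof eventually_elim
    case (elim y)
    have lim: "(\<lambda>n. S n - y) \<longlonglongrightarrow> t - y" by (intro tendsto_intros S)
    show ?case
    proof (cases "y < t")
      case True
      then have ev: "eventually (\<lambda>n. S n - y > 0) sequentially"
        using order_tendstoD(1)[OF lim, of 0] by auto
      have "(\<lambda>n. p (S n - y)) \<longlonglongrightarrow> p (t - y)"
        by (rule continuous_on_tendsto_compose[OF p(2) lim]) (use True ev in \<open>auto elim: eventually_mono\<close>)
      moreover have "eventually (\<lambda>n. p (S n - y) = zero_ext p (S n - y)) sequentially"
        using ev by eventually_elim (auto simp: zero_ext_def)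
      ultimately show ?thesis using True by (simp add: tendsto_cong zero_ext_def)
    next
      case False
      with elim have "eventually (\<lambda>n. S n - y < 0) sequentially"
        using order_tendstoD(2)[OF lim, of 0] by auto
      then have "eventually (\<lambda>n. zero_ext p (S n - y) = zero_ext p (t - y)) sequentially"
        by eventually_elim (use elim False in \<open>auto simp: zero_ext_def\<close>)
      then show ?thesis by (rule tendsto_eventually)
    qed
  qed
  moreover have "(\<lambda>n. p (S n)) \<longlonglongrightarrow> p t"
    by (rule continuous_on_tendsto_compose[OF p(2) S(2)]) (use t S in auto)
  ultimately have "(\<lambda>n. LS_conv p h (S n)) \<longlonglongrightarrow>
      p t * h 0 + (\<integral>y. indicator {0<..T} y * zero_ext p (t - y) \<partial>stieltjes h)"
    using t tT T S(1) by (intro LS_conv_sequential_limit p h) auto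
  then show "(LS_conv p h \<circ> S) \<longlonglongrightarrow> LS_conv p h t"
    using t tT by (simp add: LS_conv_eq[where T = T] o_def)
qed

lemma LS_conv_bound:
  assumes p: "is_cadlag p" and h: "mono_rc h" and t: "0 \<le> t" "t \<le> T"
    and K: "\<And>s. 0 \<le> s \<Longrightarrow> s \<le> T \<Longrightarrow> \<bar>p s\<bar> \<le> K"
  shows "\<bar>LS_conv p h t\<bar> \<le> K * (\<bar>h 0\<bar> + (h T - h 0))"
proof -
  note [measurable] = cadlag_zero_ext(3)[OF p]
  have K0: "K \<ge> 0" using K[of t] t by linarith
  have "\<bar>\<integral>y. indicator {0<..T} y * zero_ext p (t - y) \<partial>stieltjes h\<bar> \<le> K * measure (stieltjes h) {0<..T}"
    by (rule integrable_indicator_mult_bounded)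
      (use t stieltjes_Ioc(1)[OF h, of 0 T] zero_ext_bounded[where p = p and T = T, OF K K0] in auto)
  then have "\<bar>\<integral>y. indicator {0<..T} y * zero_ext p (t - y) \<partial>stieltjes h\<bar> \<le> K * (h T - h 0)"
    using stieltjes_Ioc(2)[OF h, of 0 T] t by simp
  moreover have "\<bar>p t * h 0\<bar> \<le> K * \<bar>h 0\<bar>"
    using K[OF t] by (simp add: abs_mult mult_right_mono)
  ultimately show ?thesis
    using abs_triangle_ineq[of "p t * h 0" "\<integral>y. indicator {0<..T} y * zero_ext p (t - y) \<partial>stieltjes h"]
    by (simp add: LS_conv_eq[OF t] distrib_left)
qed

lemma LS_conv_diff:
  assumes p: "is_cadlag p" and q: "is_cadlag q" and h: "mono_rc h" and t: "0 \<le> t"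
  shows "LS_conv p h t - LS_conv q h t = LS_conv (\<lambda>s. p s - q s) h t"
proof -
  note [measurable] = cadlag_zero_ext(3)[OF p] cadlag_zero_ext(3)[OF q]
  have int: "integrable (stieltjes h) (\<lambda>y. indicator {0<..t} y * zero_ext r (t - y))" if r: "is_cadlag r" for r
  proof -
    obtain K where K: "K \<ge> 0" "\<And>s. 0 \<le> s \<Longrightarrow> s \<le> t \<Longrightarrow> \<bar>r s\<bar> \<le> K"
      by (rule cadlag_bounded[OF r, of t]) auto
    note [measurable] = cadlag_zero_ext(3)[OF r]
    show ?thesis
      by (rule integrable_indicator_mult_bounded[where K = K])
        (use t stieltjes_Ioc(1)[OF h, of 0 t] zero_ext_bounded[where p = r and T = t, OF K(2) K(1)] in auto)
  qed
  have "(\<integral>y. indicator {0<..t} y * zero_ext (\<lambda>s. p s - q s) (t - y) \<partial>stieltjes h) =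
      (\<integral>y. indicator {0<..t} y * zero_ext p (t - y) - indicator {0<..t} y * zero_ext q (t - y) \<partial>stieltjes h)"
    by (intro Bochner_Integration.integral_cong) (auto simp: zero_ext_def indicator_def)
  also have "\<dots> = (\<integral>y. indicator {0<..t} y * zero_ext p (t - y) \<partial>stieltjes h)
      - (\<integral>y. indicator {0<..t} y * zero_ext q (t - y) \<partial>stieltjes h)"
    by (intro Bochner_Integration.integral_diff int p q)
  finally show ?thesis
    using t by (simp add: LS_conv_eq[where T = t] algebra_simps)
qed

subsection \<open>Riemann sums\<close>

text \<open>
  The increment of \<open>h\<close> over a cell is weighted with \<open>p\<close> at the left end point \<open>s\<close> of the cell. For \<open>y\<close> in
  the cell \<open>t - s\<close> lies strictly to the right of \<open>t - y\<close>, which is why the sums converge for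
  right-continuous \<open>p\<close>. The first summand accounts for the atom of \<open>h\<close> at 0.
\<close>

definition riemann :: "nat \<Rightarrow> (real \<Rightarrow> real) \<Rightarrow> (real \<Rightarrow> real) \<Rightarrow> real \<Rightarrow> real" where
  "riemann n p h t = p t * h 0 +
     (\<Sum>k<n. p (t - real k * t / n) * (h ((real k + 1) * t / n) - h (real k * t / n)))"

text \<open>
  The function of \<open>y\<close> whose integral over \<open>(0,t]\<close> is the sum in \<open>riemann\<close>.
\<close>

definition step_integrand :: "nat \<Rightarrow> (real \<Rightarrow> real) \<Rightarrow> real \<Rightarrow> real \<Rightarrow> real" where
  "step_integrand n p t y = (\<Sum>k<n. indicator {real k * t / n <.. (real k + 1) * t / n} y * p (t - real k * t / n))"

lemma step_integrand_cases:
  assumes "t > 0" "n > 0"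
  shows "y \<notin> {0<..t} \<Longrightarrow> step_integrand n p t y = 0"
    and "y \<in> {0<..t} \<Longrightarrow> \<exists>s. 0 \<le> s \<and> s < y \<and> y \<le> s + t / n \<and> step_integrand n p t y = p (t - s)"
proof -
  assume y: "y \<notin> {0<..t}"
  have "y \<notin> {real k * t / n <.. (real k + 1) * t / n}" if "k < n" for k :: nat
  proof -
    have "0 \<le> k * t / n" using assms by simp
    moreover have "(real k + 1) * t \<le> n * t"
      using assms that by (intro mult_right_mono) auto
    then have "(real k + 1) * t / n \<le> t" using assms by (simp add: field_simps)
    ultimately show ?thesis using y by auto
  qed
  then show "step_integrand n p t y = 0"
    unfolding step_integrand_def by (intro sum.neutral) auto
next
  assume y: "y \<in> {0<..t}"
  define k where "k = nat (\<lceil>y * n / t\<rceil> - 1)"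
  have "0 < y * n / t" using y assms by auto
  then have "\<lceil>y * n / t\<rceil> \<ge> 1" by linarith
  then have kk: "int k = \<lceil>y * n / t\<rceil> - 1" by (simp add: k_def)
  have iff: "y \<in> {real j * t / n <.. (real j + 1) * t / n} \<longleftrightarrow> j = k" for j :: nat
  proof -
    have "y \<in> {real j * t / n <.. (real j + 1) * t / n} \<longleftrightarrow> real j < y * n / t \<and> y * n / t \<le> j + 1"
      using assms by (auto simp: field_simps)
    also have "\<dots> \<longleftrightarrow> \<lceil>y * n / t\<rceil> = int j + 1"
      by (subst ceiling_eq_iff) auto
    also have "\<dots> \<longleftrightarrow> j = k" using kk by auto
    finally show ?thesis .
  qed
  have "y * n / t \<le> n" using y assms by (simp add: field_simps)
  then have "\<lceil>y * n / t\<rceil> \<le> int n" by linarith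
  then have "k < n" using kk by linarith
  have "step_integrand n p t y = (\<Sum>j<n. if j = k then p (t - real j * t / n) else 0)"
    unfolding step_integrand_def by (intro sum.cong refl) (simp only: indicator_def iff, simp)
  also have "\<dots> = p (t - k * t / n)" using \<open>k < n\<close> by simp
  finally have "step_integrand n p t y = p (t - k * t / n)" .
  moreover have "k * t / n < y" "y \<le> k * t / n + t / n"
    using iff[of k] by (auto simp: add_divide_distrib distrib_right)
  moreover have "0 \<le> k * t / n" using assms by simp
  ultimately show "\<exists>s. 0 \<le> s \<and> s < y \<and> y \<le> s + t / n \<and> step_integrand n p t y = p (t - s)"
    by blast
qed

lemma step_integrand_measurable [measurable]: "step_integrand n p t \<in> borel_measurable borel"
  unfolding step_integrand_def by measurable

lemma riemann_eq_integral:
  assumes h: "mono_rc h" and t: "t > 0" and n: "n > 0"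
  shows "riemann n p h t = p t * h 0 + (\<integral>y. indicator {0<..t} y * step_integrand n p t y \<partial>stieltjes h)"
proof -
  have le: "0 \<le> real k * t / n" "real k * t / n \<le> (real k + 1) * t / n" for k :: nat
    using t n by (auto simp: field_simps)
  have "(\<integral>y. indicator {0<..t} y * step_integrand n p t y \<partial>stieltjes h) =
      (\<integral>y. step_integrand n p t y \<partial>stieltjes h)"
    using step_integrand_cases(1)[OF t n] by (intro Bochner_Integration.integral_cong) (auto simp: indicator_def)
  also have "\<dots> = (\<Sum>k<n. \<integral>y. indicator {real k * t / n <.. (real k + 1) * t / n} y * p (t - real k * t / n) \<partial>stieltjes h)"
    unfolding step_integrand_def
    using stieltjes_Ioc(1)[OF h le]
    by (intro Bochner_Integration.integral_sum integrable_mult_left integrable_real_indicator) auto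
  also have "\<dots> = (\<Sum>k<n. p (t - real k * t / n) * (h ((real k + 1) * t / n) - h (real k * t / n)))"
    using stieltjes_Ioc(2)[OF h le] by (intro sum.cong) auto
  finally show ?thesis by (simp add: riemann_def)
qed

text \<open>
  This expresses a convolution through values of \<open>p\<close> and \<open>h\<close> at countably many times. Statements on
  convolutions that are evident for finite sums, such as measurability in a parameter and behaviour
  under scaling, follow by passage to the limit.
\<close>

lemma riemann_tendsto_LS_conv:
  assumes p: "is_cadlag p" and h: "mono_rc h" and t: "t \<ge> 0"
  shows "(\<lambda>n. riemann (Suc n) p h t) \<longlonglongrightarrow> LS_conv p h t"
proof (cases "t = 0")
  case True
  then show ?thesis
    by (simp add: riemann_def LS_conv_def LS_integral_def set_lebesgue_integral_def)
next
  case False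
  with t have t: "t > 0" by simp
  obtain K where K: "K \<ge> 0" "\<And>s. 0 \<le> s \<Longrightarrow> s \<le> t \<Longrightarrow> \<bar>p s\<bar> \<le> K"
    using cadlag_bounded[OF p] by metis
  note [measurable] = cadlag_zero_ext(3)[OF p]
  have "(\<lambda>n. \<integral>y. indicator {0<..t} y * step_integrand (Suc n) p t y \<partial>stieltjes h)
      \<longlonglongrightarrow> (\<integral>y. indicator {0<..t} y * zero_ext p (t - y) \<partial>stieltjes h)"
  proof (rule integral_dominated_convergence[where w = "\<lambda>y. K * indicator {0<..t} y"])
    show "integrable (stieltjes h) (\<lambda>y. K * indicator {0<..t} y)"
      using stieltjes_Ioc(1)[OF h, of 0 t] t
      by (intro integrable_mult_right integrable_real_indicator) auto
    show "AE y in stieltjes h. (\<lambda>n. indicator {0<..t} y * step_integrand (Suc n) p t y)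
        \<longlonglongrightarrow> indicator {0<..t} y * zero_ext p (t - y)"
    proof (intro always_eventually allI)
      fix y
      show "(\<lambda>n. indicator {0<..t} y * step_integrand (Suc n) p t y) \<longlonglongrightarrow> indicator {0<..t} y * zero_ext p (t - y)"
      proof (cases "y \<in> {0<..t}")
        case True
        have "\<forall>n. \<exists>s. 0 \<le> s \<and> s < y \<and> y \<le> s + t / Suc n \<and> step_integrand (Suc n) p t y = p (t - s)"
          using step_integrand_cases(2)[OF t _ True] by blast
        then obtain s where s: "\<And>n. 0 \<le> s n" "\<And>n. s n < y" "\<And>n. y \<le> s n + t / Suc n"
          "\<And>n. step_integrand (Suc n) p t y = p (t - s n)"
          by metis
        have lim0: "(\<lambda>n. t / real (Suc n)) \<longlonglongrightarrow> 0"
          using tendsto_mult[OF tendsto_const LIMSEQ_Suc[OF lim_1_over_n], of t] by simp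
        have "(\<lambda>n. (t - y) + t / real (Suc n)) \<longlonglongrightarrow> (t - y) + 0"
          by (intro tendsto_intros lim0)
        then have lim1: "(\<lambda>n. (t - y) + t / real (Suc n)) \<longlonglongrightarrow> t - y" by simp
        have bounds: "t - y \<le> t - s n" "t - s n \<le> (t - y) + t / real (Suc n)" for n
          using s(2)[of n] s(3)[of n] by linarith+
        have "(\<lambda>n. t - s n) \<longlonglongrightarrow> t - y"
          by (rule tendsto_sandwich[OF always_eventually always_eventually tendsto_const lim1])
            (use bounds in blast)+
        then have "filterlim (\<lambda>n. t - s n) (at_right (t - y)) sequentially"
          unfolding filterlim_at using s(2) by (auto intro!: always_eventually simp: less_imp_neq)
        then have "(\<lambda>n. p (t - s n)) \<longlonglongrightarrow> p (t - y)"
          using is_cadlag_right_limit[OF p, of "t - y"] True by (auto intro: filterlim_compose)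
        then show ?thesis using True by (simp add: s(4) zero_ext_def)
      qed simp
    qed
    fix n
    show "AE y in stieltjes h. norm (indicator {0<..t} y * step_integrand (Suc n) p t y) \<le> K * indicator {0<..t} y"
    proof (intro always_eventually allI)
      fix y
      show "norm (indicator {0<..t} y * step_integrand (Suc n) p t y) \<le> K * indicator {0<..t} y"
      proof (cases "y \<in> {0<..t}")
        case True
        then obtain s where "0 \<le> s" "s < y" "step_integrand (Suc n) p t y = p (t - s)"
          using step_integrand_cases(2)[OF t, of "Suc n" y] by auto
        then show ?thesis using True K(2)[of "t - s"] by auto
      qed simp
    qed
  qed simp_all
  then show ?thesis
    using t by (simp add: riemann_eq_integral[OF h] LS_conv_eq[where T = t] tendsto_add del: of_nat_Suc)
qed

text \<open>
  The error bound depends on \<open>h\<close> only through its total mass; it is therefore uniform over \<open>t\<close> in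
  bounded intervals and along convergent sequences of \<open>h\<close>.
\<close>

lemma riemann_error:
  assumes p: "is_cadlag p" and h: "mono_rc h" and t: "t \<ge> 0" and n: "n > 0"
    and w: "\<And>u v. u \<in> {0..t} \<Longrightarrow> v \<in> {0..t} \<Longrightarrow> \<bar>u - v\<bar> \<le> t / n \<Longrightarrow> \<bar>p u - p v\<bar> \<le> w"
  shows "\<bar>LS_conv p h t - riemann n p h t\<bar> \<le> w * (h t - h 0)"
proof (cases "t = 0")
  case True
  then show ?thesis
    by (simp add: riemann_def LS_conv_def LS_integral_def set_lebesgue_integral_def)
next
  case False
  with t have t: "t > 0" by simp
  obtain K where K: "K \<ge> 0" "\<And>s. 0 \<le> s \<Longrightarrow> s \<le> t \<Longrightarrow> \<bar>p s\<bar> \<le> K"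
    using cadlag_bounded[OF p] by metis
  note [measurable] = cadlag_zero_ext(3)[OF p]
  have fin: "emeasure (stieltjes h) {0<..t} < \<infinity>"
    using stieltjes_Ioc(1)[OF h, of 0 t] t by simp
  have step: "\<exists>s. 0 \<le> s \<and> s < y \<and> y \<le> s + t / n \<and> step_integrand n p t y = p (t - s)"
    if "y \<in> {0<..t}" for y
    using step_integrand_cases(2)[OF t n that] .
  have int1: "integrable (stieltjes h) (\<lambda>y. indicator {0<..t} y * zero_ext p (t - y))"
    by (rule integrable_indicator_mult_bounded[OF _ fin, where K = K])
      (use zero_ext_bounded[where p = p and T = t, OF K(2) K(1)] in auto)
  have int2: "integrable (stieltjes h) (\<lambda>y. indicator {0<..t} y * step_integrand n p t y)"
  proof (rule integrable_indicator_mult_bounded[OF _ fin])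
    fix y assume y: "y \<in> {0<..t}"
    then show "\<bar>step_integrand n p t y\<bar> \<le> K" using step[OF y] K(2)[of "t - _"] by force
  qed auto
  have "LS_conv p h t - riemann n p h t =
      (\<integral>y. indicator {0<..t} y * (zero_ext p (t - y) - step_integrand n p t y) \<partial>stieltjes h)"
    using Bochner_Integration.integral_diff[OF int1 int2] t
    by (simp add: riemann_eq_integral[OF h _ n] LS_conv_eq[where T = t] right_diff_distrib)
  also have "\<bar>\<dots>\<bar> \<le> w * measure (stieltjes h) {0<..t}"
  proof (rule integrable_indicator_mult_bounded(2)[OF _ fin])
    fix y assume y: "y \<in> {0<..t}"
    then obtain s where "0 \<le> s" "s < y" "y \<le> s + t / n" "step_integrand n p t y = p (t - s)"
      using step by blast
    then show "\<bar>zero_ext p (t - y) - step_integrand n p t y\<bar> \<le> w"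
      using y w[of "t - y" "t - s"] by (auto simp: zero_ext_def)
  qed auto
  finally show ?thesis using stieltjes_Ioc(2)[OF h, of 0 t] t by simp
qed

section \<open>Convolution powers\<close>

lemma LS_power_Suc_Suc: "LS_power (Suc (Suc j)) g = LS_conv (LS_power (Suc j) g) g"
  by (simp add: fun_eq_iff LS_conv_def)

lemma LS_power_1: "LS_power (Suc 0) g = g"
  by (simp add: fun_eq_iff)

lemma is_cadlag_LS_power: "mono_rc g \<Longrightarrow> is_cadlag (LS_power (Suc j) g)"
  by (induction j) (simp_all only: LS_power_1 LS_power_Suc_Suc mono_rc_is_cadlag is_cadlag_LS_conv)

lemma continuous_LS_power:
  "mono_rc g \<Longrightarrow> continuous_on {0..} g \<Longrightarrow> continuous_on {0..} (LS_power (Suc j) g)"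
proof (induction j)
  case 0
  then show ?case by (simp only: LS_power_1)
next
  case (Suc j)
  then show ?case
    unfolding LS_power_Suc_Suc by (intro continuous_LS_conv is_cadlag_LS_power) auto
qed

lemma riemann_scale:
  assumes p: "\<And>s. s \<ge> 0 \<Longrightarrow> p' s = p (s * a) / b"
    and h: "\<And>s. s \<ge> 0 \<Longrightarrow> h' s = h (s * a) / c" and t: "t \<ge> 0"
  shows "riemann (Suc n) p' h' t = riemann (Suc n) p h (t * a) / (b * c)"
proof -
  let ?n = "real (Suc n)"
  have summand: "p' (t - real k * t / ?n) * (h' ((real k + 1) * t / ?n) - h' (real k * t / ?n)) =
      p (t * a - real k * (t * a) / ?n) *
        (h ((real k + 1) * (t * a) / ?n) - h (real k * (t * a) / ?n)) / (b * c)"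
    if "k < Suc n" for k
  proof -
    have "real k * t \<le> ?n * t"
      using that t by (intro mult_right_mono) auto
    then have "0 \<le> t - real k * t / ?n" by (simp add: field_simps)
    from p[OF this] have "p' (t - real k * t / ?n) = p (t * a - real k * (t * a) / ?n) / b"
      by (simp only: left_diff_distrib times_divide_eq_left mult.assoc)
    moreover have "h' ((real k + 1) * t / ?n) = h ((real k + 1) * (t * a) / ?n) / c"
      using h[of "(real k + 1) * t / ?n"] t by (simp only: times_divide_eq_left mult.assoc) simp
    moreover have "h' (real k * t / ?n) = h (real k * (t * a) / ?n) / c"
      using h[of "real k * t / ?n"] t by (simp only: times_divide_eq_left mult.assoc) simp
    ultimately show ?thesis by (simp only: diff_divide_distrib[symmetric] times_divide_times_eq)
  qed
  have "riemann (Suc n) p' h' t = p (t * a) / b * (h 0 / c) + (\<Sum>k<Suc n. p (t * a - real k * (t * a) / ?n) *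
        (h ((real k + 1) * (t * a) / ?n) - h (real k * (t * a) / ?n)) / (b * c))"
    unfolding riemann_def using p[OF t] h[of 0] summand by (intro arg_cong2[of _ _ _ _ "(+)"] sum.cong) auto
  then show ?thesis
    by (simp only: riemann_def add_divide_distrib sum_divide_distrib times_divide_times_eq)
qed

text \<open>
  The change of variables is carried out on Riemann sums, where it is an identity between the
  summands, and transferred to the convolutions by uniqueness of limits.
\<close>

lemma LS_power_scale:
  assumes g: "mono_rc g" and g': "mono_rc g'" and a: "a \<ge> 0"
    and scale: "\<And>s. s \<ge> 0 \<Longrightarrow> g' s = g (s * a) / c"
    and t: "t \<ge> 0"
  shows "LS_power (Suc j) g' t = LS_power (Suc j) g (t * a) / c ^ Suc j"
  using t
proof (induction j arbitrary: t)
  case 0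
  then show ?case using scale by simp
next
  case (Suc j)
  let ?p = "LS_power (Suc j) g" and ?p' = "LS_power (Suc j) g'"
  have "riemann (Suc n) ?p' g' t = riemann (Suc n) ?p g (t * a) / (c ^ Suc j * c)" for n
    by (rule riemann_scale) (fact Suc.IH scale Suc.prems)+
  then have "riemann (Suc n) ?p' g' t = riemann (Suc n) ?p g (t * a) / c ^ Suc (Suc j)" for n
    by (simp only: power_Suc2)
  then have "(\<lambda>n. riemann (Suc n) ?p g (t * a) / c ^ Suc (Suc j)) \<longlonglongrightarrow> LS_conv ?p' g' t"
    using riemann_tendsto_LS_conv[OF is_cadlag_LS_power[OF g', of j] g' Suc.prems] by (simp only:)
  moreover have "(\<lambda>n. riemann (Suc n) ?p g (t * a) / c ^ Suc (Suc j)) \<longlonglongrightarrow> LS_conv ?p g (t * a) / c ^ Suc (Suc j)"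
    unfolding divide_inverse
    by (intro tendsto_mult_right riemann_tendsto_LS_conv is_cadlag_LS_power g mult_nonneg_nonneg Suc.prems a)
  ultimately show ?case
    unfolding LS_power_Suc_Suc by (rule LIMSEQ_unique)
qed

lemma LS_power_cong:
  assumes "mono_rc g" "mono_rc g'" "\<And>s. s \<ge> 0 \<Longrightarrow> g' s = g s" "t \<ge> 0"
  shows "LS_power (Suc j) g' t = LS_power (Suc j) g t"
  using LS_power_scale[of g g' 1 1 t j] assms by (simp del: LS_power.simps)

lemma borel_measurable_LS_power:
  assumes P: "\<And>s. s \<ge> 0 \<Longrightarrow> P s \<in> borel_measurable M"
    and mono: "\<And>\<omega>. \<omega> \<in> space M \<Longrightarrow> mono_rc (\<lambda>s. P s \<omega>)" and t: "t \<ge> 0"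
  shows "(\<lambda>\<omega>. LS_power (Suc j) (\<lambda>s. P s \<omega>) t) \<in> borel_measurable M"
  using t
proof (induction j arbitrary: t)
  case 0
  then show ?case using P by simp
next
  case (Suc j)
  show ?case unfolding LS_power_Suc_Suc
  proof (rule borel_measurable_LIMSEQ_real)
    fix \<omega> assume "\<omega> \<in> space M"
    then show "(\<lambda>n. riemann (Suc n) (LS_power (Suc j) (\<lambda>s. P s \<omega>)) (\<lambda>s. P s \<omega>) t)
        \<longlonglongrightarrow> LS_conv (LS_power (Suc j) (\<lambda>s. P s \<omega>)) (\<lambda>s. P s \<omega>) t"
      by (intro riemann_tendsto_LS_conv is_cadlag_LS_power mono Suc.prems)
  next
    fix n
    have nonneg: "0 \<le> t - real k * t / Suc n" if "k < Suc n" for k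
    proof -
      have "real k * t \<le> Suc n * t"
        using that Suc.prems by (intro mult_right_mono) auto
      then show ?thesis by (simp add: field_simps)
    qed
    show "(\<lambda>\<omega>. riemann (Suc n) (LS_power (Suc j) (\<lambda>s. P s \<omega>)) (\<lambda>s. P s \<omega>) t) \<in> borel_measurable M"
      unfolding riemann_def
      by (intro borel_measurable_add borel_measurable_times borel_measurable_sum borel_measurable_diff Suc.IH P)
        (use Suc.prems nonneg in \<open>auto simp del: of_nat_Suc\<close>)
  qed
qed

lemma riemann_diff_bound:
  assumes K: "\<And>s. 0 \<le> s \<Longrightarrow> s \<le> T \<Longrightarrow> \<bar>f s\<bar> \<le> K"
    and d: "\<And>s. 0 \<le> s \<Longrightarrow> s \<le> T \<Longrightarrow> \<bar>y s - z s\<bar> \<le> d"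
    and t: "0 \<le> t" "t \<le> T" and n: "n > 0"
  shows "\<bar>riemann n f y t - riemann n f z t\<bar> \<le> K * d * (1 + 2 * real n)"
proof -
  have K0: "K \<ge> 0" and d0: "d \<ge> 0" using K[OF t] d[OF t] by linarith+
  let ?D = "\<lambda>k. f (t - real k * t / n) * (y ((real k + 1) * t / n) - y (real k * t / n)) -
        f (t - real k * t / n) * (z ((real k + 1) * t / n) - z (real k * t / n))"
  have summand: "\<bar>?D k\<bar> \<le> K * (2 * d)" if k: "k \<in> {..<n}" for k
  proof -
    have "(real k + 1) * t \<le> n * t" using k t by (intro mult_right_mono) auto
    then have 1: "0 \<le> real k * t / n" "real k * t / n \<le> (real k + 1) * t / n" "(real k + 1) * t / n \<le> t"
      using t n by (auto simp: field_simps)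
    have le: "real k * t / n \<le> t" "0 \<le> (real k + 1) * t / n"
      using order_trans[OF 1(2,3)] order_trans[OF 1(1,2)] by auto
    have le': "t - real k * t / n \<le> T" using 1(1) t(2) by (rule order_trans[OF diff_le_eq[THEN iffD2, OF add_increasing2[OF _ order_refl]]])
    have 2: "0 \<le> real k * t / n" "real k * t / n \<le> T" "0 \<le> (real k + 1) * t / n" "(real k + 1) * t / n \<le> T"
      "0 \<le> t - real k * t / n" "t - real k * t / n \<le> T"
      using 1(1,3) le le' t by (auto intro: order_trans)
    have "?D k = f (t - real k * t / n) * ((y ((real k + 1) * t / n) - z ((real k + 1) * t / n)) - (y (real k * t / n) - z (real k * t / n)))"
      by (simp add: algebra_simps)
    also have "\<bar>\<dots>\<bar> \<le> K * (2 * d)"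
      unfolding abs_mult using K[OF 2(5,6)] d[OF 2(1,2)] d[OF 2(3,4)] K0
      by (intro mult_mono) auto
    finally show ?thesis .
  qed
  have sum_le: "(\<Sum>k<n. \<bar>?D k\<bar>) \<le> (\<Sum>k<n. K * (2 * d))"
    by (rule sum_mono) (erule summand)
  have start: "\<bar>f t * (y 0 - z 0)\<bar> \<le> K * d"
    unfolding abs_mult using K[OF t] d[of 0] t K0 by (intro mult_mono) auto
  have eq: "riemann n f y t - riemann n f z t = f t * (y 0 - z 0) + (\<Sum>k<n. ?D k)"
    unfolding riemann_def sum_subtractf right_diff_distrib[of "f t"] by linarith
  have "\<bar>riemann n f y t - riemann n f z t\<bar> \<le> \<bar>f t * (y 0 - z 0)\<bar> + (\<Sum>k<n. \<bar>?D k\<bar>)"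
    unfolding eq by (intro order_trans[OF abs_triangle_ineq] add_left_mono sum_abs)
  also have "\<dots> \<le> K * d + (\<Sum>k<n. K * (2 * d))"
    by (rule add_mono[OF start sum_le])
  also have "\<dots> = K * d * (1 + 2 * real n)" by (simp add: algebra_simps)
  finally show ?thesis .
qed

text \<open>
  The difference between the convolutions splits into four parts. Replacing \<open>f\<^sub>n\<close> by \<open>g\<close> costs the
  uniform distance times the mass of \<open>y\<^sub>n\<close>; passing to Riemann sums with \<open>N\<close> cells costs the modulus of
  continuity of \<open>g\<close> times the mass, once for \<open>y\<^sub>n\<close> and once for \<open>z\<close>; and the two Riemann sums, with
  \<open>N\<close> fixed, differ by a multiple of the uniform distance between \<open>y\<^sub>n\<close> and \<open>z\<close>.
\<close>

lemma uniform_limit_LS_conv: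
  assumes f: "\<And>n. is_cadlag (f n)" "is_cadlag g" "continuous_on {0..} g"
    and y: "\<And>n. mono_rc (y n)" "mono_rc z" and "T \<ge> 0"
    and lim_f: "uniform_limit {0..T} f g sequentially"
    and lim_y: "uniform_limit {0..T} y z sequentially"
  shows "uniform_limit {0..T} (\<lambda>n. LS_conv (f n) (y n)) (LS_conv g z) sequentially"
  unfolding uniform_limit_iff
proof (intro allI impI)
  fix e :: real assume "e > 0"
  obtain K where K: "K \<ge> 0" "\<And>s. 0 \<le> s \<Longrightarrow> s \<le> T \<Longrightarrow> \<bar>g s\<bar> \<le> K"
    using cadlag_bounded[OF f(2)] by metis
  \<comment> \<open>\<open>C\<close> bounds the mass, atom at 0 included, of every nondecreasing path within distance 1 of \<open>z\<close>.\<close>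
  define C where "C = \<bar>z 0\<bar> + (z T - z 0) + 3"
  have zT: "z 0 \<le> z T" using mono_rc_le[OF y(2), of 0 T] \<open>T \<ge> 0\<close> by simp
  then have C: "C \<ge> 3" by (simp add: C_def)
  define w where "w = e / (4 * C)"
  have w: "w > 0" "w * C = e / 4" using C \<open>e > 0\<close> by (auto simp: w_def)
  have "uniformly_continuous_on {0..T} g"
    by (rule compact_uniformly_continuous[OF continuous_on_subset[OF f(3)]]) auto
  then obtain del where del: "del > 0"
    "\<And>u v. u \<in> {0..T} \<Longrightarrow> v \<in> {0..T} \<Longrightarrow> \<bar>u - v\<bar> < del \<Longrightarrow> \<bar>g u - g v\<bar> < w"
    using w(1) unfolding uniformly_continuous_on_def dist_real_def by metis
  obtain N :: nat where N: "T / del < N" using reals_Archimedean2 by blast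
  with \<open>T \<ge> 0\<close> del have N0: "N > 0" by (cases N) (auto simp: divide_less_0_iff)
  have TN: "T / N < del" using N N0 del by (simp add: field_simps)
  \<comment> \<open>The Riemann sums with \<open>N\<close> cells for two paths at distance \<open>d\<close> differ by less than \<open>e / 4\<close>.\<close>
  define d where "d = min 1 (e / (8 * ((K + 1) * (1 + 2 * real N))))"
  have d: "d > 0" "d \<le> 1" using K(1) \<open>e > 0\<close> by (auto simp: d_def intro!: divide_pos_pos mult_pos_pos)
  have Kd: "K * d * (1 + 2 * real N) < e / 4"
  proof -
    have pos: "(K + 1) * (1 + 2 * real N) > 0" using K(1) by (intro mult_pos_pos) auto
    have "K * d * (1 + 2 * real N) \<le> (K + 1) * d * (1 + 2 * real N)"
      using K(1) d by (intro mult_right_mono) auto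
    also have "\<dots> = d * ((K + 1) * (1 + 2 * real N))" by simp
    also have "\<dots> \<le> e / (8 * ((K + 1) * (1 + 2 * real N))) * ((K + 1) * (1 + 2 * real N))"
      using pos by (intro mult_right_mono) (auto simp: d_def)
    also have "\<dots> = e / 8"
    proof -
      have "e / (8 * P) * P = e / 8" if "P > 0" for P :: real
        using that by simp
      then show ?thesis using pos .
    qed
    also have "\<dots> < e / 4" using \<open>e > 0\<close> by simp
    finally show ?thesis .
  qed
  have "eventually (\<lambda>n. \<forall>s\<in>{0..T}. \<bar>f n s - g s\<bar> < w) sequentially"
    using lim_f w(1) by (auto simp: uniform_limit_iff dist_real_def)
  moreover have "eventually (\<lambda>n. \<forall>s\<in>{0..T}. \<bar>y n s - z s\<bar> < d) sequentially"
    using lim_y d(1) by (auto simp: uniform_limit_iff dist_real_def)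
  ultimately show "eventually (\<lambda>n. \<forall>t\<in>{0..T}. dist (LS_conv (f n) (y n) t) (LS_conv g z t) < e) sequentially"
  proof eventually_elim
    case (elim n)
    have mass: "\<bar>y n 0\<bar> + (y n T - y n 0) \<le> C"
      using bspec[OF elim(2), of 0] bspec[OF elim(2), of T] \<open>T \<ge> 0\<close> d(2) unfolding C_def by auto
    show ?case
    proof
      fix t assume tT: "t \<in> {0..T}"
      then have t: "0 \<le> t" "t \<le> T" by auto
      have mono: "h 0 \<le> h t" "h t \<le> h T" if "mono_rc h" for h
        using mono_rc_le[OF that] t by auto
      have gw: "\<bar>g u - g v\<bar> \<le> w" if "u \<in> {0..t}" "v \<in> {0..t}" "\<bar>u - v\<bar> \<le> t / N" for u v
      proof -
        have "t / N \<le> T / N" using t by (intro divide_right_mono) auto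
        then show ?thesis using del(2)[of u v] that t TN by auto
      qed
      have err: "\<bar>LS_conv g h t - riemann N g h t\<bar> \<le> e / 4" if h: "mono_rc h" "h T - h 0 \<le> C" for h
      proof -
        have "\<bar>LS_conv g h t - riemann N g h t\<bar> \<le> w * (h t - h 0)"
          by (rule riemann_error[OF f(2) h(1) t(1) N0 gw])
        also have "\<dots> \<le> w * C" using w(1) mono[OF h(1)] h(2) by (intro mult_left_mono) auto
        finally show ?thesis using w by simp
      qed
      have "\<bar>LS_conv (f n) (y n) t - LS_conv g (y n) t\<bar> \<le> w * (\<bar>y n 0\<bar> + (y n T - y n 0))"
        unfolding LS_conv_diff[OF f(1,2) y(1) t(1)]
        by (rule LS_conv_bound[OF _ y(1) t])
          (use elim(1) in \<open>auto intro!: less_imp_le is_cadlag_diff f\<close>)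
      also have "\<dots> \<le> w * C" using w(1) mass by (intro mult_left_mono) auto
      finally have 1: "\<bar>LS_conv (f n) (y n) t - LS_conv g (y n) t\<bar> \<le> e / 4" using w by simp
      have 2: "\<bar>LS_conv g (y n) t - riemann N g (y n) t\<bar> \<le> e / 4"
        using mass by (intro err y(1)) auto
      have 3: "\<bar>riemann N g (y n) t - riemann N g z t\<bar> \<le> K * d * (1 + 2 * real N)"
        by (rule riemann_diff_bound[OF K(2) _ t N0]) (use elim(2) in \<open>auto intro: less_imp_le\<close>)
      have 4: "\<bar>LS_conv g z t - riemann N g z t\<bar> \<le> e / 4"
        by (intro err y(2)) (auto simp: C_def)
      show "dist (LS_conv (f n) (y n) t) (LS_conv g z t) < e"
        using 1 2 le_less_trans[OF 3 Kd] 4 unfolding dist_real_def by linarith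
    qed
  qed
qed

lemma uniform_limit_LS_power:
  assumes y: "\<And>n. mono_rc (y n)" "mono_rc z" "continuous_on {0..} z" and T: "T \<ge> 0"
    and lim: "uniform_limit {0..T} y z sequentially"
  shows "uniform_limit {0..T} (\<lambda>n. LS_power (Suc j) (y n)) (LS_power (Suc j) z) sequentially"
proof (induction j)
  case 0
  then show ?case using lim by (simp only: LS_power_1)
next
  case (Suc j)
  then show ?case
    unfolding LS_power_Suc_Suc
    by (intro uniform_limit_LS_conv is_cadlag_LS_power continuous_LS_power y T lim)
qed

section \<open>The \<open>J\<^sub>1\<close>-metric\<close>

lemma time_changes_id: "(\<lambda>t. t) \<in> time_changes T"
  by (auto simp: time_changes_def strict_mono_on_def)

lemma time_changes_range: "\<tau> \<in> time_changes T \<Longrightarrow> t \<in> {0..T} \<Longrightarrow> \<tau> t \<in> {0..T}"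
  by (auto simp: time_changes_def)

lemma time_changes_comp:
  assumes "\<sigma> \<in> time_changes T" "\<tau> \<in> time_changes T"
  shows "(\<lambda>t. \<sigma> (\<tau> t)) \<in> time_changes T"
proof -
  have "\<tau> ` {0..T} = {0..T}" "\<sigma> ` {0..T} = {0..T}" using assms by (auto simp: time_changes_def)
  then have "(\<lambda>t. \<sigma> (\<tau> t)) ` {0..T} = {0..T}" 
    by (subst image_image[symmetric]) simp
  moreover have "strict_mono_on {0..T} (\<lambda>t. \<sigma> (\<tau> t))"
    using assms time_changes_range[OF assms(2)]
    by (auto simp: time_changes_def strict_mono_on_def simp del: atLeastAtMost_iff)
  moreover have "continuous_on {0..T} (\<lambda>t. \<sigma> (\<tau> t))"
    by (rule continuous_on_compose2[of "{0..T}" \<sigma>]) (use assms in \<open>simp_all add: time_changes_def\<close>)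
  ultimately show ?thesis by (simp add: time_changes_def)
qed

lemma time_changes_inverse:
  assumes "\<tau> \<in> time_changes T"
  obtains \<sigma> where "\<sigma> \<in> time_changes T" "\<And>t. t \<in> {0..T} \<Longrightarrow> \<sigma> (\<tau> t) = t"
    "\<And>t. t \<in> {0..T} \<Longrightarrow> \<tau> (\<sigma> t) = t"
proof -
  have sm: "strict_mono_on {0..T} \<tau>" and ct: "continuous_on {0..T} \<tau>" and im: "\<tau> ` {0..T} = {0..T}"
    using assms by (auto simp: time_changes_def)
  have inj: "inj_on \<tau> {0..T}" by (rule strict_mono_on_imp_inj_on[OF sm])
  define \<sigma> where "\<sigma> = the_inv_into {0..T} \<tau>"
  have 1: "\<sigma> (\<tau> t) = t" if "t \<in> {0..T}" for t
    using that inj by (simp add: \<sigma>_def the_inv_into_f_f)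
  have 2: "\<tau> (\<sigma> t) = t" if "t \<in> {0..T}" for t
    using that inj im by (simp add: \<sigma>_def f_the_inv_into_f)
  have 3: "\<sigma> ` {0..T} = {0..T}"
    by (metis (no_types, lifting) 1 im image_cong image_ident image_image)
  have "strict_mono_on {0..T} \<sigma>"
    unfolding strict_mono_on_def
  proof (intro allI impI)
    fix r s assume rs: "r \<in> {0..T} \<and> s \<in> {0..T} \<and> r < s"
    then have "\<sigma> r \<in> {0..T}" "\<sigma> s \<in> {0..T}" using 3 by blast+
    then have "\<sigma> s \<le> \<sigma> r \<Longrightarrow> \<tau> (\<sigma> s) \<le> \<tau> (\<sigma> r)"
      using sm unfolding strict_mono_on_def by (metis less_eq_real_def)
    then show "\<sigma> r < \<sigma> s" using 2 rs by (metis not_le)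
  qed
  moreover have "continuous_on {0..T} \<sigma>"
    using continuous_on_inv[OF ct compact_Icc, of \<sigma>] 1 im by auto
  ultimately show ?thesis using 1 2 3 by (intro that[of \<sigma>]) (auto simp: time_changes_def)
qed

text \<open>
  A supremum of reals bounds the values only if they are bounded above. Hence smallness of
  \<open>J1_dist_on\<close> gives information on the values only for paths that are bounded on \<open>[0,T]\<close>, as cadlag
  paths are.
\<close>

definition bounded_path :: "real \<Rightarrow> (real \<Rightarrow> real) \<Rightarrow> bool" where
  "bounded_path T x \<longleftrightarrow> (\<exists>K. \<forall>t\<in>{0..T}. \<bar>x t\<bar> \<le> K)"

lemma time_change_bdd_above:
  assumes "\<tau> \<in> time_changes T"
  shows "bdd_above ((\<lambda>t. \<bar>\<tau> t - t\<bar>) ` {0..T})"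
proof (rule bdd_aboveI2)
  fix t assume "t \<in> {0..T}"
  then show "\<bar>\<tau> t - t\<bar> \<le> T" using time_changes_range[OF assms, of t] by auto
qed

lemma J1_cost_nonneg:
  assumes "T \<ge> 0" "\<tau> \<in> time_changes T"
  shows "0 \<le> max (SUP t\<in>{0..T}. \<bar>\<tau> t - t\<bar>) (SUP t\<in>{0..T}. \<bar>x t - y (\<tau> t)\<bar>)"
proof -
  have "0 \<le> \<bar>\<tau> 0 - 0\<bar>" by simp
  also have "\<dots> \<le> (SUP t\<in>{0..T}. \<bar>\<tau> t - t\<bar>)"
    using assms by (intro cSUP_upper time_change_bdd_above) auto
  finally show ?thesis by simp
qed

lemma J1_dist_on_nonneg: "T \<ge> 0 \<Longrightarrow> 0 \<le> J1_dist_on T x y"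
  unfolding J1_dist_on_def using time_changes_id[of T]
  by (intro cINF_greatest J1_cost_nonneg) auto

text \<open>
  The next two lemmas replace the definition of \<open>J1_dist_on\<close>: a distance is small if and, for bounded
  paths, only if some time change brings the paths close. Symmetry and the triangle inequality then
  correspond to inverting and composing time changes.
\<close>

lemma J1_dist_on_leI:
  assumes "T \<ge> 0" "\<tau> \<in> time_changes T" "\<And>t. t \<in> {0..T} \<Longrightarrow> \<bar>\<tau> t - t\<bar> \<le> e"
    and "\<And>t. t \<in> {0..T} \<Longrightarrow> \<bar>x t - y (\<tau> t)\<bar> \<le> e"
  shows "J1_dist_on T x y \<le> e"
proof -
  have "J1_dist_on T x y \<le> max (SUP t\<in>{0..T}. \<bar>\<tau> t - t\<bar>) (SUP t\<in>{0..T}. \<bar>x t - y (\<tau> t)\<bar>)"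
    unfolding J1_dist_on_def using assms
    by (intro cINF_lower bdd_belowI2[where m = 0] J1_cost_nonneg)
  also have "\<dots> \<le> e"
    using assms by (intro max.boundedI cSUP_least) auto
  finally show ?thesis .
qed

lemma J1_dist_on_lessD:
  assumes "T \<ge> 0" "J1_dist_on T x y < e" "bounded_path T x" "bounded_path T y"
  obtains \<tau> where "\<tau> \<in> time_changes T" "\<And>t. t \<in> {0..T} \<Longrightarrow> \<bar>\<tau> t - t\<bar> < e"
    "\<And>t. t \<in> {0..T} \<Longrightarrow> \<bar>x t - y (\<tau> t)\<bar> < e"
proof -
  have "\<exists>\<tau>\<in>time_changes T. max (SUP t\<in>{0..T}. \<bar>\<tau> t - t\<bar>) (SUP t\<in>{0..T}. \<bar>x t - y (\<tau> t)\<bar>) < e"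
    using assms(1,2) time_changes_id[of T] unfolding J1_dist_on_def
    by (subst (asm) cINF_less_iff) (auto intro!: bdd_belowI2[where m = 0] J1_cost_nonneg simp del: max_less_iff_conj)
  then obtain \<tau> where \<tau>: "\<tau> \<in> time_changes T" "(SUP t\<in>{0..T}. \<bar>\<tau> t - t\<bar>) < e"
    "(SUP t\<in>{0..T}. \<bar>x t - y (\<tau> t)\<bar>) < e" by auto
  obtain K L where KL: "\<And>t. t \<in> {0..T} \<Longrightarrow> \<bar>x t\<bar> \<le> K" "\<And>t. t \<in> {0..T} \<Longrightarrow> \<bar>y t\<bar> \<le> L"
    using assms(3,4) unfolding bounded_path_def by blast
  have bdd: "bdd_above ((\<lambda>t. \<bar>x t - y (\<tau> t)\<bar>) ` {0..T})"
  proof (rule bdd_aboveI2)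
    fix t assume t: "t \<in> {0..T}"
    show "\<bar>x t - y (\<tau> t)\<bar> \<le> K + L"
      using KL(1)[OF t] KL(2)[OF time_changes_range[OF \<tau>(1) t]] by linarith
  qed
  show ?thesis
  proof (rule that[OF \<tau>(1)])
    fix t assume t: "t \<in> {0..T}"
    show "\<bar>\<tau> t - t\<bar> < e"
      using cSUP_upper[OF t time_change_bdd_above[OF \<tau>(1)]] \<tau>(2) by linarith
    show "\<bar>x t - y (\<tau> t)\<bar> < e"
      using cSUP_upper[OF t bdd] \<tau>(3) by linarith
  qed
qed

lemma J1_dist_on_refl: "T \<ge> 0 \<Longrightarrow> J1_dist_on T x x = 0"
  by (intro antisym J1_dist_on_nonneg J1_dist_on_leI[OF _ time_changes_id]) auto

lemma J1_dist_on_commute_le: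
  assumes T: "T \<ge> 0" and b: "bounded_path T x" "bounded_path T y"
  shows "J1_dist_on T x y \<le> J1_dist_on T y x"
proof (rule field_le_epsilon)
  fix e :: real assume "e > 0"
  then obtain \<tau> where \<tau>: "\<tau> \<in> time_changes T" "\<And>t. t \<in> {0..T} \<Longrightarrow> \<bar>\<tau> t - t\<bar> < J1_dist_on T y x + e"
    "\<And>t. t \<in> {0..T} \<Longrightarrow> \<bar>y t - x (\<tau> t)\<bar> < J1_dist_on T y x + e"
    using J1_dist_on_lessD[OF T _ b(2,1), of "J1_dist_on T y x + e"] by auto
  obtain \<sigma> where \<sigma>: "\<sigma> \<in> time_changes T" "\<And>t. t \<in> {0..T} \<Longrightarrow> \<tau> (\<sigma> t) = t"
    using time_changes_inverse[OF \<tau>(1)] by metis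
  show "J1_dist_on T x y \<le> J1_dist_on T y x + e"
  proof (rule J1_dist_on_leI[OF T \<sigma>(1)])
    fix t assume t: "t \<in> {0..T}"
    note s = time_changes_range[OF \<sigma>(1) t]
    show "\<bar>\<sigma> t - t\<bar> \<le> J1_dist_on T y x + e" "\<bar>x t - y (\<sigma> t)\<bar> \<le> J1_dist_on T y x + e"
      using \<tau>(2)[OF s] \<tau>(3)[OF s] \<sigma>(2)[OF t] by (simp_all add: abs_minus_commute)
  qed
qed

lemma J1_dist_on_triangle:
  assumes T: "T \<ge> 0" and b: "bounded_path T x" "bounded_path T y" "bounded_path T z"
  shows "J1_dist_on T x z \<le> J1_dist_on T x y + J1_dist_on T y z"
proof (rule field_le_epsilon)
  fix e :: real assume e: "e > 0"
  obtain \<tau> where \<tau>: "\<tau> \<in> time_changes T" "\<And>t. t \<in> {0..T} \<Longrightarrow> \<bar>\<tau> t - t\<bar> < J1_dist_on T x y + e / 2"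
    "\<And>t. t \<in> {0..T} \<Longrightarrow> \<bar>x t - y (\<tau> t)\<bar> < J1_dist_on T x y + e / 2"
    using J1_dist_on_lessD[OF T _ b(1,2), of "J1_dist_on T x y + e / 2"] e by auto
  obtain \<sigma> where \<sigma>: "\<sigma> \<in> time_changes T" "\<And>t. t \<in> {0..T} \<Longrightarrow> \<bar>\<sigma> t - t\<bar> < J1_dist_on T y z + e / 2"
    "\<And>t. t \<in> {0..T} \<Longrightarrow> \<bar>y t - z (\<sigma> t)\<bar> < J1_dist_on T y z + e / 2"
    using J1_dist_on_lessD[OF T _ b(2,3), of "J1_dist_on T y z + e / 2"] e by auto
  show "J1_dist_on T x z \<le> J1_dist_on T x y + J1_dist_on T y z + e"
  proof (rule J1_dist_on_leI[OF T time_changes_comp[OF \<sigma>(1) \<tau>(1)]])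
    fix t assume t: "t \<in> {0..T}"
    note s = time_changes_range[OF \<tau>(1) t]
    show "\<bar>\<sigma> (\<tau> t) - t\<bar> \<le> J1_dist_on T x y + J1_dist_on T y z + e"
      using \<tau>(2)[OF t] \<sigma>(2)[OF s] by linarith
    show "\<bar>x t - z (\<sigma> (\<tau> t))\<bar> \<le> J1_dist_on T x y + J1_dist_on T y z + e"
      using \<tau>(3)[OF t] \<sigma>(3)[OF s] by linarith
  qed
qed

definition cut :: "nat \<Rightarrow> cadlag \<Rightarrow> real \<Rightarrow> real" where
  "cut m x t = cutoff (real m) t * cadlag_fun x t"

lemma cutoff_bounds: "0 \<le> cutoff m t" "cutoff m t \<le> 1"
  by (auto simp: cutoff_def)

lemma cutoff_lipschitz: "\<bar>cutoff m s - cutoff m t\<bar> \<le> \<bar>s - t\<bar>"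
  by (auto simp: cutoff_def)

lemma bounded_path_cut: "bounded_path T (cut m x)"
proof -
  obtain K where K: "K \<ge> 0" "\<And>t. 0 \<le> t \<Longrightarrow> t \<le> T \<Longrightarrow> \<bar>cadlag_fun x t\<bar> \<le> K"
    using cadlag_bounded[OF is_cadlag_cadlag_fun] by metis
  have "\<bar>cut m x t\<bar> \<le> 1 * K" if "t \<in> {0..T}" for t
    unfolding cut_def abs_mult using K that cutoff_bounds[of "real m" t]
    by (intro mult_mono) auto
  then show ?thesis unfolding bounded_path_def by blast
qed

definition J1_level :: "nat \<Rightarrow> cadlag \<Rightarrow> cadlag \<Rightarrow> real" where
  "J1_level m x y = J1_dist_on (real m) (cut m x) (cut m y)"

lemma J1_dist_eq: "J1_dist x y = (\<Sum>k. (1 / 2) ^ Suc k * min 1 (J1_level (Suc k) x y))"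
  unfolding J1_dist_def J1_level_def Let_def cut_def[abs_def] ..

lemma J1_level_nonneg: "0 \<le> J1_level m x y"
  by (simp add: J1_level_def J1_dist_on_nonneg)

lemma J1_level_commute: "J1_level m x y = J1_level m y x"
  unfolding J1_level_def by (intro antisym J1_dist_on_commute_le bounded_path_cut) auto

lemma J1_level_triangle: "J1_level m x z \<le> J1_level m x y + J1_level m y z"
  unfolding J1_level_def by (intro J1_dist_on_triangle bounded_path_cut) auto

lemma summable_half_powers: "summable (\<lambda>k. (1 / 2 :: real) ^ Suc k)"
  by (simp add: summable_mult summable_geometric)

lemma J1_dist_summable: "summable (\<lambda>k. (1 / 2) ^ Suc k * min 1 (J1_level (Suc k) x y))"
proof (rule summable_comparison_test'[OF summable_half_powers, of 0])
  fix k
  have "(1 / 2) ^ Suc k * min 1 (J1_level (Suc k) x y) \<le> (1 / 2) ^ Suc k * 1"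
    by (intro mult_left_mono) auto
  then show "norm ((1 / 2) ^ Suc k * min 1 (J1_level (Suc k) x y)) \<le> (1 / 2) ^ Suc k"
    using J1_level_nonneg[of "Suc k" x y] by (simp add: abs_mult)
qed

lemma J1_level_le_J1_dist: "(1 / 2) ^ Suc k * min 1 (J1_level (Suc k) x y) \<le> J1_dist x y"
proof -
  have "(\<Sum>i\<in>{k}. (1 / 2) ^ Suc i * min 1 (J1_level (Suc i) x y)) \<le> J1_dist x y"
    unfolding J1_dist_eq using J1_level_nonneg
    by (intro sum_le_suminf J1_dist_summable) auto
  then show ?thesis by simp
qed

lemma J1_level_less_of_J1_dist:
  assumes "e > 0"
  obtains d where "d > 0" "\<And>x y. J1_dist x y < d \<Longrightarrow> J1_level (Suc k) x y < e"
proof (rule that[of "(1 / 2) ^ Suc k * min 1 e"])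
  fix x y assume "J1_dist x y < (1 / 2) ^ Suc k * min 1 e"
  then have "(1 / 2) ^ Suc k * min 1 (J1_level (Suc k) x y) < (1 / 2) ^ Suc k * min 1 e"
    using J1_level_le_J1_dist by (rule le_less_trans[rotated])
  then have "min 1 (J1_level (Suc k) x y) < min 1 e" by (simp only: mult_less_cancel_left_pos zero_less_power half_gt_zero_iff zero_less_one zero_less_divide_iff zero_less_numeral simp_thms)
  then show "J1_level (Suc k) x y < e" by (auto simp: min_def split: if_splits)
qed (use assms in auto)

lemma J1_dist_refl: "J1_dist x x = 0"
  by (simp add: J1_dist_eq J1_level_def J1_dist_on_refl)

lemma cut_eq: "real m \<ge> t + 1 \<Longrightarrow> cut m x t = cadlag_fun x t"
  by (simp add: cut_def cutoff_def)

text \<open>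
  By right continuity both paths are nearly constant on an interval \<open>[t, t + d)\<close>. A time change
  that moves points by less than \<open>d / 2\<close> keeps the midpoint inside this interval, so the
  values at \<open>t\<close> are close to each other.
\<close>

lemma J1_dist_zero_imp_eq:
  assumes "J1_dist x y = 0"
  shows "x = y"
proof -
  have "cadlag_fun x t = cadlag_fun y t" if t: "t \<ge> 0" for t
  proof -
    have "\<bar>cadlag_fun x t - cadlag_fun y t\<bar> \<le> 3 * e" if e: "e > 0" for e
    proof -
      obtain d1 where d1: "d1 > 0" "\<And>s. t \<le> s \<Longrightarrow> s < t + d1 \<Longrightarrow> \<bar>cadlag_fun x s - cadlag_fun x t\<bar> < e"
        using cadlag_local_oscillation[OF is_cadlag_cadlag_fun e t] by metis
      obtain d2 where d2: "d2 > 0" "\<And>s. t \<le> s \<Longrightarrow> s < t + d2 \<Longrightarrow> \<bar>cadlag_fun y s - cadlag_fun y t\<bar> < e"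
        using cadlag_local_oscillation[OF is_cadlag_cadlag_fun e t] by metis
      define d where "d = min 1 (min d1 d2)"
      have d: "d > 0" "d \<le> 1" "d \<le> d1" "d \<le> d2" using d1(1) d2(1) by (auto simp: d_def)
      obtain k :: nat where k: "t + 2 \<le> real k" using real_arch_simple by blast
      define s where "s = t + d / 2"
      have "J1_level (Suc k) x y < min e (d / 2)"
        using J1_level_less_of_J1_dist[of "min e (d / 2)" k] e d(1) assms by (metis half_gt_zero min_less_iff_conj)
      then obtain \<tau> where \<tau>': "\<And>t. t \<in> {0..real (Suc k)} \<Longrightarrow> \<bar>\<tau> t - t\<bar> < min e (d / 2)"
        "\<And>t. t \<in> {0..real (Suc k)} \<Longrightarrow> \<bar>cut (Suc k) x t - cut (Suc k) y (\<tau> t)\<bar> < min e (d / 2)"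
        unfolding J1_level_def using J1_dist_on_lessD[OF _ _ bounded_path_cut bounded_path_cut] by (metis of_nat_0_le_iff)
      have "s \<in> {0..real (Suc k)}" using t d k by (auto simp: s_def)
      note \<tau> = \<tau>'[OF this]
      have "\<bar>\<tau> s - s\<bar> < d / 2" using \<tau>(1) by simp
      then have near: "t < \<tau> s" "\<tau> s < t + d" unfolding s_def by linarith+
      have "cut (Suc k) x s = cadlag_fun x s" "cut (Suc k) y (\<tau> s) = cadlag_fun y (\<tau> s)"
        using near d k by (auto intro!: cut_eq simp: s_def)
      moreover have "\<bar>cadlag_fun x s - cadlag_fun x t\<bar> < e"
        using d by (intro d1(2)) (auto simp: s_def)
      moreover have "\<bar>cadlag_fun y (\<tau> s) - cadlag_fun y t\<bar> < e"
        using near d by (intro d2(2)) auto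
      ultimately show ?thesis using \<tau>(2) by linarith
    qed
    from this[of "\<bar>cadlag_fun x t - cadlag_fun y t\<bar> / 6"] show ?thesis by (cases "cadlag_fun x t = cadlag_fun y t") auto
  qed
  then have "cadlag_fun x = cadlag_fun y"
    by (metis cadlag_fun_neg ext not_le)
  then show ?thesis by (simp add: cadlag_fun_inject)
qed

lemma J1_dist_triangle2: "J1_dist x y \<le> J1_dist x z + J1_dist y z"
proof -
  let ?t = "\<lambda>x y k. (1 / 2) ^ Suc k * min 1 (J1_level (Suc k) x y)"
  have le: "?t x y k \<le> ?t x z k + ?t y z k" for k
  proof -
    have "min 1 (J1_level (Suc k) x y) \<le> min 1 (J1_level (Suc k) x z) + min 1 (J1_level (Suc k) y z)"
      using J1_level_triangle[of "Suc k" x y z] J1_level_commute[of "Suc k" z y]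
        J1_level_nonneg[of "Suc k" x z] J1_level_nonneg[of "Suc k" y z] by linarith
    then show ?thesis unfolding distrib_left[symmetric] by (rule mult_left_mono) auto
  qed
  have "J1_dist x y \<le> (\<Sum>k. ?t x z k + ?t y z k)"
    unfolding J1_dist_eq by (intro suminf_le le summable_add J1_dist_summable)
  also have "\<dots> = J1_dist x z + J1_dist y z"
    unfolding J1_dist_eq by (intro suminf_add[symmetric] J1_dist_summable)
  finally show ?thesis .
qed

text \<open>
  The topology of \<open>cadlag\<close> is by definition the one of \<open>J1_dist\<close>. With the metric made explicit, the
  product \<open>nat \<Rightarrow> cadlag\<close> becomes a metric space too, and pointwise limits of Borel functions into
  it are Borel.
\<close>

instantiation cadlag :: metric_space
begin

definition dist_cadlag :: "cadlag \<Rightarrow> cadlag \<Rightarrow> real" where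
  "dist_cadlag = J1_dist"

definition uniformity_cadlag :: "(cadlag \<times> cadlag) filter" where
  "uniformity_cadlag = (INF e\<in>{0<..}. principal {(x, y). dist x y < e})"

instance
proof
  fix x y z :: cadlag
  show "dist x y = 0 \<longleftrightarrow> x = y"
    unfolding dist_cadlag_def using J1_dist_refl J1_dist_zero_imp_eq by blast
  show "dist x y \<le> dist x z + dist y z"
    unfolding dist_cadlag_def by (rule J1_dist_triangle2)
next
  fix U :: "cadlag set"
  have "eventually P uniformity \<longleftrightarrow> (\<exists>e>0. \<forall>x (y::cadlag). dist x y < e \<longrightarrow> P (x, y))" for P
    unfolding uniformity_cadlag_def
    by (subst eventually_INF_base)
      (auto simp: eventually_principal subset_eq intro: bexI[of _ "min _ _"])
  then show "open U = (\<forall>x\<in>U. \<forall>\<^sub>F (x', y) in uniformity. x' = x \<longrightarrow> y \<in> U)"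
    unfolding open_cadlag_def dist_cadlag_def by auto
qed (simp add: uniformity_cadlag_def)

end

subsection \<open>\<open>J\<^sub>1\<close>-convergence and locally uniform convergence\<close>

lemma cadlag_tendstoI:
  fixes x :: "nat \<Rightarrow> cadlag"
  assumes "\<And>k. (\<lambda>n. J1_level (Suc k) (x n) y) \<longlonglongrightarrow> 0"
  shows "x \<longlonglongrightarrow> y"
proof -
  have "((\<lambda>n. \<Sum>k. (1 / 2) ^ Suc k * min 1 (J1_level (Suc k) (x n) y)) \<longlongrightarrow> (\<Sum>k. (1 / 2) ^ Suc k * min 1 0)) sequentially"
  proof (rule tannerys_theorem[where M = "\<lambda>k. (1 / 2) ^ Suc k", THEN conjunct2, THEN conjunct2])
    fix k show "((\<lambda>n. (1 / 2) ^ Suc k * min 1 (J1_level (Suc k) (x n) y)) \<longlongrightarrow> (1 / 2) ^ Suc k * min 1 0) sequentially"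
      by (intro tendsto_intros assms)
  next
    have "norm ((1 / 2) ^ Suc k * min 1 (J1_level (Suc k) (x n) y)) \<le> (1 / 2) ^ Suc k" for k n
      using J1_level_nonneg[of "Suc k" "x n" y] mult_left_mono[of "min 1 (J1_level (Suc k) (x n) y)" 1 "(1 / 2) ^ Suc k"]
      by (simp add: abs_mult)
    then show "\<forall>\<^sub>F (k, n) in sequentially \<times>\<^sub>F sequentially. norm ((1 / 2) ^ Suc k * min 1 (J1_level (Suc k) (x n) y)) \<le> (1 / 2) ^ Suc k"
      by (auto intro: always_eventually)
  qed (auto simp: summable_half_powers)
  then have "(\<lambda>n. dist (x n) y) \<longlonglongrightarrow> 0"
    by (simp add: dist_cadlag_def J1_dist_eq)
  then show ?thesis by (rule iffD2[OF tendsto_dist_iff])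
qed

lemma cadlag_tendsto_of_uniform_limit:
  fixes x :: "nat \<Rightarrow> cadlag"
  assumes "\<And>T. T \<ge> 0 \<Longrightarrow> uniform_limit {0..T} (\<lambda>n. cadlag_fun (x n)) (cadlag_fun y) sequentially"
  shows "x \<longlonglongrightarrow> y"
proof (rule cadlag_tendstoI, rule tendstoI)
  fix k and e :: real assume e: "e > 0"
  have "eventually (\<lambda>n. \<forall>t\<in>{0..real (Suc k)}. dist (cadlag_fun (x n) t) (cadlag_fun y t) < e / 2) sequentially"
    using uniform_limitD[OF assms[of "real (Suc k)"], of "e / 2"] e by auto
  then show "eventually (\<lambda>n. dist (J1_level (Suc k) (x n) y) 0 < e) sequentially"
  proof eventually_elim
    case (elim n)
    have "J1_level (Suc k) (x n) y \<le> e / 2"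
      unfolding J1_level_def
    proof (rule J1_dist_on_leI[OF _ time_changes_id])
      fix t assume t: "t \<in> {0..real (Suc k)}"
      have "\<bar>cut (Suc k) (x n) t - cut (Suc k) y t\<bar> =
          cutoff (real (Suc k)) t * \<bar>cadlag_fun (x n) t - cadlag_fun y t\<bar>"
        using cutoff_bounds(1)[of "real (Suc k)" t]
        by (simp add: cut_def right_diff_distrib[symmetric] abs_mult)
      also have "\<dots> \<le> 1 * (e / 2)"
        using elim t cutoff_bounds[of "real (Suc k)" t]
        by (intro mult_mono) (auto simp: dist_real_def intro: less_imp_le)
      finally show "\<bar>cut (Suc k) (x n) t - cut (Suc k) y t\<bar> \<le> e / 2" by simp
    qed (use e in auto)
    then show ?case using J1_level_nonneg[of "Suc k" "x n" y] e by (simp add: dist_real_def)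
  qed
qed

text \<open>
  The time change moves the argument of the continuous limit only slightly, and uniform continuity
  on a compact interval absorbs this displacement. The horizon is chosen so large that the
  cutoff equals 1 on \<open>[0,T]\<close>.
\<close>

lemma uniform_limit_of_cadlag_tendsto:
  fixes x :: "nat \<Rightarrow> cadlag"
  assumes lim: "x \<longlonglongrightarrow> z" and cont: "continuous_on {0..} (cadlag_fun z)"
  shows "uniform_limit {0..T} (\<lambda>n. cadlag_fun (x n)) (cadlag_fun z) sequentially"
  unfolding uniform_limit_iff
proof (intro allI impI)
  fix e :: real assume e: "e > 0"
  obtain k :: nat where k: "T + 1 \<le> real k" using real_arch_simple by blast
  let ?m = "real (Suc k)"
  have "continuous_on {0..?m} (cutoff ?m)"
    by (rule lipschitz_on_continuous_on[where L = 1], rule lipschitz_onI)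
      (use cutoff_lipschitz in \<open>auto simp: dist_real_def\<close>)
  then have "continuous_on {0..?m} (cut (Suc k) z)"
    unfolding cut_def[abs_def] by (intro continuous_intros continuous_on_subset[OF cont]) auto
  then have "uniformly_continuous_on {0..?m} (cut (Suc k) z)"
    by (rule compact_uniformly_continuous) auto
  then obtain d where d: "d > 0" "\<And>u v. u \<in> {0..?m} \<Longrightarrow> v \<in> {0..?m} \<Longrightarrow> \<bar>u - v\<bar> < d \<Longrightarrow>
      \<bar>cut (Suc k) z u - cut (Suc k) z v\<bar> < e / 2"
    unfolding uniformly_continuous_on_def dist_real_def using e by (metis half_gt_zero)
  obtain d' where d': "d' > 0" "\<And>x y. J1_dist x y < d' \<Longrightarrow> J1_level (Suc k) x y < min d (e / 2)"
    using J1_level_less_of_J1_dist[of "min d (e / 2)" k] d(1) e by auto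
  have "eventually (\<lambda>n. dist (x n) z < d') sequentially"
    using tendstoD[OF lim d'(1)] .
  then show "eventually (\<lambda>n. \<forall>t\<in>{0..T}. dist (cadlag_fun (x n) t) (cadlag_fun z t) < e) sequentially"
  proof eventually_elim
    case (elim n)
    then have "J1_level (Suc k) (x n) z < min d (e / 2)" by (intro d'(2)) (simp add: dist_cadlag_def)
    then obtain \<tau> where \<tau>: "\<tau> \<in> time_changes ?m" "\<And>t. t \<in> {0..?m} \<Longrightarrow> \<bar>\<tau> t - t\<bar> < min d (e / 2)"
      "\<And>t. t \<in> {0..?m} \<Longrightarrow> \<bar>cut (Suc k) (x n) t - cut (Suc k) z (\<tau> t)\<bar> < min d (e / 2)"
      unfolding J1_level_def using J1_dist_on_lessD[OF _ _ bounded_path_cut bounded_path_cut] by (metis of_nat_0_le_iff)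
    show ?case
    proof
      fix t assume "t \<in> {0..T}"
      then have t: "t \<in> {0..?m}" and tk: "t + 1 \<le> ?m" using k by auto
      have "\<bar>cut (Suc k) z (\<tau> t) - cut (Suc k) z t\<bar> < e / 2"
        using \<tau>(2)[OF t] by (intro d(2) time_changes_range[OF \<tau>(1)] t) auto
      with \<tau>(3)[OF t] show "dist (cadlag_fun (x n) t) (cadlag_fun z t) < e"
        unfolding cut_eq[OF tk] dist_real_def by linarith
    qed
  qed
qed

lemma fun_tendstoI:
  fixes x :: "nat \<Rightarrow> 'i \<Rightarrow> 'c::topological_space"
  assumes "\<And>i. (\<lambda>n. x n i) \<longlonglongrightarrow> y i"
  shows "x \<longlonglongrightarrow> y"
proof -
  have "limitin (product_topology (\<lambda>_. euclidean) UNIV) x y sequentially"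
    using assms by (simp add: limitin_componentwise)
  then show ?thesis
    by (simp add: euclidean_product_topology)
qed

section \<open>Discretisation of cadlag paths\<close>

definition grid_step :: "nat \<Rightarrow> (nat \<Rightarrow> real) \<Rightarrow> real \<Rightarrow> real" where
  "grid_step n v t = v (nat \<lfloor>t * real (Suc n)\<rfloor>)"

lemma is_cadlag_grid_step: "is_cadlag (grid_step n v)"
proof -
  let ?N = "real (Suc n)"
  have right: "(grid_step n v \<longlongrightarrow> grid_step n v t) (at_right t)" for t
  proof -
    have "eventually (\<lambda>s. s < (real_of_int \<lfloor>t * ?N\<rfloor> + 1) / ?N) (at_right t)"
      using floor_approx_right(2)[of t n] order_tendstoD(2)[OF tendsto_ident_at] by blast
    then have "eventually (\<lambda>s. s < (real_of_int \<lfloor>t * ?N\<rfloor> + 1) / ?N \<and> s > t) (at_right t)"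
      by (intro eventually_conj eventually_at_right_less)
    then have "eventually (\<lambda>s. grid_step n v s = grid_step n v t) (at_right t)"
    proof eventually_elim
      case (elim s)
      have "s * ?N < real_of_int \<lfloor>t * ?N\<rfloor> + 1" "t * ?N \<le> s * ?N"
        using elim by (auto simp: pos_less_divide_eq simp del: of_nat_Suc)
      then have "\<lfloor>s * ?N\<rfloor> = \<lfloor>t * ?N\<rfloor>" by linarith
      then show ?case by (simp only: grid_step_def)
    qed
    then show ?thesis by (rule tendsto_eventually)
  qed
  have left: "(grid_step n v \<longlongrightarrow> v (nat (\<lceil>t * ?N\<rceil> - 1))) (at_left t)" for t
  proof -
    have "(real_of_int \<lceil>t * ?N\<rceil> - 1) / ?N < t"
      by (subst pos_divide_less_eq) linarith+
    then have "eventually (\<lambda>s. s > (real_of_int \<lceil>t * ?N\<rceil> - 1) / ?N) (at_left t)"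
      using order_tendstoD(1)[OF tendsto_ident_at] by blast
    then have "eventually (\<lambda>s. s > (real_of_int \<lceil>t * ?N\<rceil> - 1) / ?N \<and> s < t) (at_left t)"
      by (intro eventually_conj) (auto simp: eventually_at_filter)
    then have "eventually (\<lambda>s. grid_step n v s = v (nat (\<lceil>t * ?N\<rceil> - 1))) (at_left t)"
    proof eventually_elim
      case (elim s)
      have "s * ?N > real_of_int \<lceil>t * ?N\<rceil> - 1" "s * ?N < t * ?N"
        using elim by (auto simp: pos_divide_less_eq simp del: of_nat_Suc)
      then have "\<lfloor>s * ?N\<rfloor> = \<lceil>t * ?N\<rceil> - 1" by linarith
      then show ?case by (simp only: grid_step_def)
    qed
    then show ?thesis by (rule tendsto_eventually)
  qed
  show ?thesis unfolding is_cadlag_def continuous_within using left right by blast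
qed

text \<open>
  On a bounded time interval only finitely many coordinates of \<open>v\<close> are seen, so that
  coordinatewise convergence gives uniform convergence there.
\<close>

lemma continuous_grid_step: "continuous_on UNIV (\<lambda>v. to_cadlag (grid_step n v))"
  unfolding continuous_on_sequentially comp_def
proof (intro allI ballI impI)
  fix V :: "nat \<Rightarrow> nat \<Rightarrow> real" and v
  assume "(\<forall>m. V m \<in> UNIV) \<and> V \<longlonglongrightarrow> v"
  then have "V \<longlonglongrightarrow> v" by simp
  then have lim: "(\<lambda>m. V m k) \<longlonglongrightarrow> v k" for k
    using continuous_on_tendsto_compose[where f = "\<lambda>v. v k", OF continuous_on_product_coordinates \<open>V \<longlonglongrightarrow> v\<close>] by simp
  show "(\<lambda>m. to_cadlag (grid_step n (V m))) \<longlonglongrightarrow> to_cadlag (grid_step n v)"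
  proof (rule cadlag_tendsto_of_uniform_limit)
    fix T :: real
    show "uniform_limit {0..T} (\<lambda>m. cadlag_fun (to_cadlag (grid_step n (V m)))) (cadlag_fun (to_cadlag (grid_step n v))) sequentially"
      unfolding uniform_limit_iff
    proof (intro allI impI)
      fix e :: real assume "e > 0"
      let ?k = "nat \<lfloor>T * real (Suc n)\<rfloor>"
      have "eventually (\<lambda>m. \<forall>k\<in>{..?k}. dist (V m k) (v k) < e) sequentially"
        using tendstoD[OF lim \<open>e > 0\<close>] by (intro eventually_ball_finite) auto
      then show "eventually (\<lambda>m. \<forall>t\<in>{0..T}. dist (cadlag_fun (to_cadlag (grid_step n (V m))) t)
          (cadlag_fun (to_cadlag (grid_step n v)) t) < e) sequentially"
      proof eventually_elim
        case (elim m)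
        have "nat \<lfloor>t * real (Suc n)\<rfloor> \<le> ?k" if "t \<in> {0..T}" for t
          using that by (intro nat_mono floor_mono mult_right_mono) auto
        then show ?case
          using elim by (auto simp: cadlag_fun_to_cadlag[OF is_cadlag_grid_step] grid_step_def)
      qed
    qed
  qed
qed

text \<open>
  A time change that brings \<open>f\<close> on \<open>[0,a)\<close> within \<open>e\<close> of its discretisation on the grid of
  mesh \<open>1/(n+1)\<close>. It maps \<open>a\<close> to the first grid point at or after \<open>a\<close>: the discretisation starts to
  sample \<open>f\<close> from \<open>[a, \<infinity>)\<close> exactly at that grid point.
\<close>

definition aligned :: "(real \<Rightarrow> real) \<Rightarrow> real \<Rightarrow> nat \<Rightarrow> real \<Rightarrow> bool" where
  "aligned f e n a \<longleftrightarrow> (\<exists>\<tau>. strict_mono_on {0..a} \<tau> \<and> continuous_on {0..a} \<tau> \<and> \<tau> 0 = 0 \<and>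
     \<tau> a = real_of_int \<lceil>a * real (Suc n)\<rceil> / real (Suc n) \<and>
     (\<forall>t\<in>{0..a}. \<bar>\<tau> t - t\<bar> \<le> 1 / real (Suc n)) \<and>
     (\<forall>t\<in>{0..<a}. \<bar>f t - f (real_of_int \<lfloor>\<tau> t * real (Suc n)\<rfloor> / real (Suc n))\<bar> \<le> e))"

text \<open>
  The time change is prolonged linearly so that \<open>b\<close> too goes to the first grid point at or after \<open>b\<close>. Times
  in \<open>[a,b)\<close> are then sampled at grid points in \<open>[a,b)\<close>, where \<open>f\<close> is almost constant. The two
  grid points differ because the mesh is smaller than \<open>b - a\<close>.
\<close>

lemma aligned_extend:
  assumes al: "aligned f e n a" and ab: "0 \<le> a" "1 / real (Suc n) < b - a"
    and osc: "\<And>s. a \<le> s \<Longrightarrow> s < b \<Longrightarrow> \<bar>f s - f a\<bar> < e / 2"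
  shows "aligned f e n b"
proof -
  define N where "N = real (Suc n)"
  have N: "N > 0" by (simp add: N_def)
  have lt: "a < b" using ab(2) by (smt (verit) of_nat_0_le_iff divide_nonneg_nonneg)
  obtain \<tau> where \<tau>: "strict_mono_on {0..a} \<tau>" "continuous_on {0..a} \<tau>" "\<tau> 0 = 0"
    "\<tau> a = real_of_int \<lceil>a * N\<rceil> / N" "\<And>t. t \<in> {0..a} \<Longrightarrow> \<bar>\<tau> t - t\<bar> \<le> 1 / N"
    "\<And>t. t \<in> {0..<a} \<Longrightarrow> \<bar>f t - f (real_of_int \<lfloor>\<tau> t * N\<rfloor> / N)\<bar> \<le> e"
    using al unfolding aligned_def N_def by blast
  define A where "A = real_of_int \<lceil>a * N\<rceil> / N"
  define B where "B = real_of_int \<lceil>b * N\<rceil> / N"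
  have A: "a \<le> A" "A - a \<le> 1 / N" and B: "b \<le> B" "B - b \<le> 1 / N"
  proof -
    have *: "x \<le> real_of_int \<lceil>x * N\<rceil> / N" "real_of_int \<lceil>x * N\<rceil> / N - x \<le> 1 / N" for x
    proof -
      show "x \<le> real_of_int \<lceil>x * N\<rceil> / N" using N by (simp add: pos_le_divide_eq)
      have "real_of_int \<lceil>x * N\<rceil> / N \<le> (x * N + 1) / N"
        using N by (intro divide_right_mono) linarith+
      also have "\<dots> = x + 1 / N" using N by (simp add: field_simps)
      finally show "real_of_int \<lceil>x * N\<rceil> / N - x \<le> 1 / N" by simp
    qed
    show "a \<le> A" "A - a \<le> 1 / N" "b \<le> B" "B - b \<le> 1 / N"
      unfolding A_def B_def by (rule *)+
  qed
  have AB: "A < B" using A(2) B(1) ab(2) by (simp add: N_def)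
  define \<theta> where "\<theta> t = (t - a) / (b - a)" for t
  have \<theta>: "0 \<le> \<theta> t" "\<theta> t \<le> 1" if "a \<le> t" "t \<le> b" for t
    using that lt by (auto simp: \<theta>_def)
  have \<theta>_ab: "\<theta> a = 0" "\<theta> b = 1" using lt by (auto simp: \<theta>_def)
  have \<theta>_less: "\<theta> s < \<theta> t" if "s < t" for s t
    using that lt by (auto simp: \<theta>_def divide_strict_right_mono)
  define \<sigma> where "\<sigma> t = (if t \<le> a then \<tau> t else A + \<theta> t * (B - A))" for t
  have \<tau>a: "\<tau> a = A" using \<tau>(4) by (simp add: A_def)
  have \<sigma>_right: "\<sigma> t = A + \<theta> t * (B - A)" if "a \<le> t" for t
    using that \<tau>a \<theta>_ab by (auto simp: \<sigma>_def)
  have \<tau>_le: "\<tau> t \<le> A" if "0 \<le> t" "t \<le> a" for t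
    using \<tau>(1) that ab(1) \<tau>a unfolding strict_mono_on_def
    by (cases "t = a") (auto intro: less_imp_le)
  have "strict_mono_on {0..b} \<sigma>"
    unfolding strict_mono_on_def
  proof (intro allI impI, elim conjE)
    fix r s assume rs: "r \<in> {0..b}" "s \<in> {0..b}" "r < s"
    consider "s \<le> a" | "r \<le> a" "a < s" | "a < r" using rs(3) by linarith
    then show "\<sigma> r < \<sigma> s"
    proof cases
      case 1
      then show ?thesis using \<tau>(1) rs by (auto simp: \<sigma>_def strict_mono_on_def)
    next
      case 2
      have "0 < \<theta> s * (B - A)" using \<theta>_less[of a s] 2 \<theta>_ab AB by simp
      then show ?thesis using 2 \<tau>_le[of r] rs by (simp add: \<sigma>_def)
    next
      case 3
      then show ?thesis using \<theta>_less[OF rs(3)] rs(3) AB by (simp add: \<sigma>_def)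
    qed
  qed
  moreover have "continuous_on {0..b} \<sigma>"
  proof -
    have "continuous_on ({0..a} \<union> {a..b}) (\<lambda>t. if t \<le> a then \<tau> t else A + \<theta> t * (B - A))"
      by (intro continuous_on_If \<tau>(2)) (use lt in \<open>auto simp: \<tau>a \<theta>_ab \<theta>_def intro!: continuous_intros\<close>)
    then show ?thesis using ab(1) lt by (simp add: \<sigma>_def[abs_def] ivl_disj_un)
  qed
  moreover have "\<sigma> 0 = 0" using \<tau>(3) ab(1) by (simp add: \<sigma>_def)
  moreover have "\<sigma> b = B" using \<sigma>_right[of b] lt \<theta>_ab by simp
  moreover have "\<bar>\<sigma> t - t\<bar> \<le> 1 / N" if t: "t \<in> {0..b}" for t
  proof (cases "t \<le> a")
    case True
    then show ?thesis using \<tau>(5)[of t] t by (simp add: \<sigma>_def)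
  next
    case False
    then have th: "0 \<le> \<theta> t" "\<theta> t \<le> 1" using \<theta>[of t] t by auto
    have "t = a + \<theta> t * (b - a)" using lt by (simp add: \<theta>_def)
    then have "\<sigma> t - t = (1 - \<theta> t) * (A - a) + \<theta> t * (B - b)"
      using False by (simp add: \<sigma>_def algebra_simps)
    moreover have "(1 - \<theta> t) * (A - a) + \<theta> t * (B - b) \<le> 1 / N"
      using A B th by (intro convex_bound_le) auto
    moreover have "0 \<le> (1 - \<theta> t) * (A - a) + \<theta> t * (B - b)"
      using A B th by (intro add_nonneg_nonneg mult_nonneg_nonneg) auto
    ultimately show ?thesis by simp
  qed
  moreover have "\<bar>f t - f (real_of_int \<lfloor>\<sigma> t * N\<rfloor> / N)\<bar> \<le> e" if t: "t \<in> {0..<b}" for t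
  proof (cases "t < a")
    case True
    then show ?thesis using \<tau>(6)[of t] t by (simp add: \<sigma>_def)
  next
    case False
    then have th: "0 \<le> \<theta> t" "\<theta> t < 1" using \<theta>[of t] \<theta>_less[of t b] \<theta>_ab t by auto
    have diffs: "\<sigma> t - A = \<theta> t * (B - A)" "B - \<sigma> t = (1 - \<theta> t) * (B - A)"
      using False \<sigma>_right[of t] by (simp_all add: algebra_simps)
    have "0 \<le> \<sigma> t - A" "0 < B - \<sigma> t" unfolding diffs using th AB by auto
    then have "A \<le> \<sigma> t" "\<sigma> t < B" by simp_all
    then have "real_of_int \<lceil>a * N\<rceil> \<le> \<sigma> t * N" "\<sigma> t * N < real_of_int \<lceil>b * N\<rceil>"
      using N by (auto simp: A_def B_def pos_divide_le_eq pos_less_divide_eq)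
    then have "\<lceil>a * N\<rceil> \<le> \<lfloor>\<sigma> t * N\<rfloor>" "\<lfloor>\<sigma> t * N\<rfloor> < \<lceil>b * N\<rceil>"
      by (auto simp: le_floor_iff floor_less_iff)
    then have "a * N \<le> real_of_int \<lfloor>\<sigma> t * N\<rfloor>" "real_of_int \<lfloor>\<sigma> t * N\<rfloor> < b * N"
      by (auto simp: less_ceiling_iff ceiling_le_iff)
    then have "a \<le> real_of_int \<lfloor>\<sigma> t * N\<rfloor> / N" "real_of_int \<lfloor>\<sigma> t * N\<rfloor> / N < b"
      using N by (auto simp: pos_le_divide_eq pos_divide_less_eq)
    moreover have "\<bar>f t - f a\<bar> < e / 2" using osc[of t] False t by auto
    ultimately show ?thesis using osc[of "real_of_int \<lfloor>\<sigma> t * N\<rfloor> / N"] by linarith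
  qed
  ultimately show ?thesis
    unfolding aligned_def N_def[symmetric] B_def by (intro exI[of _ \<sigma>]) blast
qed

text \<open>
  Bisection: the claim that alignment can be continued from \<open>a\<close> to \<open>b\<close> is transitive in \<open>a\<close> and \<open>b\<close>, and
  it holds locally around each point, since an interval around \<open>x\<close> consists of a piece before \<open>x\<close>
  and one from \<open>x\<close> on, each of small oscillation.
\<close>

lemma eventually_aligned:
  assumes f: "is_cadlag f" and e: "e > 0" and T: "T \<ge> 0"
  shows "eventually (\<lambda>n. aligned f e n T) sequentially"
proof -
  define P where "P a b \<longleftrightarrow> (0 \<le> a \<longrightarrow> eventually (\<lambda>n. aligned f e n a) sequentially \<longrightarrow>
      eventually (\<lambda>n. aligned f e n b) sequentially)" for a b
  have extend: "eventually (\<lambda>n. aligned f e n b) sequentially"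
    if "eventually (\<lambda>n. aligned f e n a) sequentially" "0 \<le> a" "a < b"
      "\<And>s. a \<le> s \<Longrightarrow> s < b \<Longrightarrow> \<bar>f s - f a\<bar> < e / 2" for a b
  proof -
    have "eventually (\<lambda>n. 1 / real (Suc n) < b - a) sequentially"
      using order_tendstoD(2)[OF LIMSEQ_Suc[OF lim_1_over_n], of "b - a"] that(3) by simp
    with that(1) show ?thesis
      by eventually_elim (use that(2,4) in \<open>auto intro: aligned_extend\<close>)
  qed
  have "P 0 T"
    using T
  proof (induction rule: Bolzano)
    case (trans a b c)
    then show ?case unfolding P_def by auto
  next
    case (local x)
    obtain d where d: "d > 0"
      "\<And>a s. 0 \<le> a \<Longrightarrow> x - d < a \<Longrightarrow> a < x \<Longrightarrow> a \<le> s \<Longrightarrow> s < x \<Longrightarrow> \<bar>f s - f a\<bar> < e / 2"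
      "\<And>s. x \<le> s \<Longrightarrow> s < x + d \<Longrightarrow> \<bar>f s - f x\<bar> < e / 2"
      using cadlag_local_oscillation[OF f, of "e / 2" x] local e by auto
    have "P a b" if ab: "a \<le> x" "x \<le> b" "b - a < d" for a b
      unfolding P_def
    proof (intro impI)
      assume a: "0 \<le> a" and al: "eventually (\<lambda>n. aligned f e n a) sequentially"
      have x: "eventually (\<lambda>n. aligned f e n x) sequentially"
      proof (cases "a = x")
        case False
        then show ?thesis using ab by (intro extend[OF al a] d(2) a) auto
      qed (use al in simp)
      show "eventually (\<lambda>n. aligned f e n b) sequentially"
      proof (cases "x = b")
        case False
        then show ?thesis using ab a by (intro extend[OF x] d(3)) auto
      qed (use x in simp)
    qed
    then show ?case using d(1) by blast
  qed
  moreover have "aligned f e n 0" for n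
    unfolding aligned_def by (intro exI[of _ "\<lambda>t. t"]) (auto simp: strict_mono_on_def)
  ultimately show ?thesis by (simp add: P_def)
qed

text \<open>
  An integer horizon \<open>m\<close> is a point of every grid, so an aligning time change maps \<open>[0,m]\<close> onto itself. At
  \<open>t = m\<close>, where alignment asserts nothing, the cutoff vanishes; elsewhere the Lipschitz continuity of the
  cutoff controls the effect of the time change on it.
\<close>

lemma grid_step_tendsto:
  assumes f: "is_cadlag f"
  shows "(\<lambda>n. to_cadlag (grid_step n (\<lambda>k. f (real k / real (Suc n))))) \<longlonglongrightarrow> to_cadlag f"
proof (rule cadlag_tendstoI, rule tendstoI)
  fix j and e :: real assume e: "e > 0"
  define m where "m = real (Suc j)"
  obtain K where K: "K \<ge> 0" "\<And>t. 0 \<le> t \<Longrightarrow> t \<le> m \<Longrightarrow> \<bar>f t\<bar> \<le> K"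
    using cadlag_bounded[OF f] by metis
  have "(\<lambda>n. (K + 1) * (1 / real (Suc n))) \<longlonglongrightarrow> (K + 1) * 0"
    by (intro tendsto_intros LIMSEQ_Suc[OF lim_1_over_n])
  then have "eventually (\<lambda>n. (K + 1) * (1 / real (Suc n)) < e / 2) sequentially"
    by (rule order_tendstoD) (use e in simp)
  moreover have "eventually (\<lambda>n. aligned f (e / 4) n m) sequentially"
    using eventually_aligned[OF f, of "e / 4" m] e by (simp add: m_def)
  ultimately show "eventually (\<lambda>n. dist (J1_level (Suc j) (to_cadlag (grid_step n (\<lambda>k. f (real k / real (Suc n))))) (to_cadlag f)) 0 < e) sequentially"
  proof eventually_elim
    case (elim n)
    define N where "N = real (Suc n)"
    have N: "N > 0" by (simp add: N_def)
    let ?x = "to_cadlag (grid_step n (\<lambda>k. f (real k / real (Suc n))))"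
    have mN: "real_of_int \<lceil>m * N\<rceil> / N = m"
    proof -
      have eq: "m * N = real_of_int (int (Suc j * Suc n))" 
        unfolding m_def N_def of_int_of_nat_eq by (rule of_nat_mult[symmetric])
      have "real_of_int \<lceil>m * N\<rceil> = m * N" unfolding eq by (simp only: ceiling_of_int)
      show ?thesis unfolding \<open>real_of_int \<lceil>m * N\<rceil> = m * N\<close> using N by simp
    qed
    obtain \<tau> where \<tau>: "strict_mono_on {0..m} \<tau>" "continuous_on {0..m} \<tau>" "\<tau> 0 = 0" "\<tau> m = m"
      "\<And>t. t \<in> {0..m} \<Longrightarrow> \<bar>\<tau> t - t\<bar> \<le> 1 / N"
      "\<And>t. t \<in> {0..<m} \<Longrightarrow> \<bar>f t - f (real_of_int \<lfloor>\<tau> t * N\<rfloor> / N)\<bar> \<le> e / 4"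
      using elim(2) unfolding aligned_def N_def[symmetric] mN by blast
    have m0: "0 \<le> m" by (simp add: m_def)
    have mono: "\<tau> s \<le> \<tau> t" if "0 \<le> s" "s \<le> t" "t \<le> m" for s t
      using \<tau>(1) that unfolding strict_mono_on_def by (cases "s = t") (auto intro: less_imp_le)
    have "\<tau> ` {0..m} = {0..m}"
    proof
      show "\<tau> ` {0..m} \<subseteq> {0..m}"
        using mono[of 0] mono[of _ m] \<tau>(3,4) by auto
      show "{0..m} \<subseteq> \<tau> ` {0..m}"
      proof
        fix y assume "y \<in> {0..m}"
        then show "y \<in> \<tau> ` {0..m}"
          using IVT'[of \<tau> 0 y m] \<tau>(2,3,4) m0 by force
      qed
    qed
    then have tc: "\<tau> \<in> time_changes m" using \<tau>(1,2) by (simp add: time_changes_def)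
    have "J1_level (Suc j) (to_cadlag f) ?x \<le> e / 4 + (K + 1) * (1 / N)"
      unfolding J1_level_def m_def[symmetric]
    proof (rule J1_dist_on_leI[OF m0 tc])
      fix t assume t: "t \<in> {0..m}"
      have Kn: "0 \<le> K * (1 / N)" "0 \<le> 1 / N" using K(1) N by auto
      have split: "(K + 1) * (1 / N) = K * (1 / N) + 1 / N" by (simp only: distrib_right mult_1)
      show "\<bar>\<tau> t - t\<bar> \<le> e / 4 + (K + 1) * (1 / N)"
        unfolding split using \<tau>(5)[OF t] e Kn by linarith
      show "\<bar>cut (Suc j) (to_cadlag f) t - cut (Suc j) ?x (\<tau> t)\<bar> \<le> e / 4 + (K + 1) * (1 / N)"
      proof (cases "t = m")
        case True
        then have "cut (Suc j) (to_cadlag f) t = 0" "cut (Suc j) ?x (\<tau> t) = 0"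
          using \<tau>(4) by (auto simp: cut_def cutoff_def m_def)
        then show ?thesis unfolding split using e Kn by simp
      next
        case False
        define s where "s = real_of_int \<lfloor>\<tau> t * N\<rfloor> / N"
        have \<tau>t: "0 \<le> \<tau> t" "\<tau> t \<le> m" using time_changes_range[OF tc t] by auto
        have fl: "0 \<le> \<lfloor>\<tau> t * N\<rfloor>" using \<tau>t N by simp
        have "real_of_int \<lfloor>\<tau> t * N\<rfloor> / N \<le> \<tau> t" using N by (simp add: pos_divide_le_eq)
        then have s: "0 \<le> s" "s \<le> m" using fl N \<tau>t by (auto simp: s_def)
        have x: "cadlag_fun ?x (\<tau> t) = f s"
          using \<tau>t fl by (simp add: cadlag_fun_to_cadlag[OF is_cadlag_grid_step] grid_step_def s_def N_def[symmetric] del: of_nat_Suc)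
        let ?c = "cutoff m t" and ?c' = "cutoff m (\<tau> t)"
        have "cut (Suc j) (to_cadlag f) t - cut (Suc j) ?x (\<tau> t) = ?c * (f t - f s) + (?c - ?c') * f s"
          using t by (simp add: cut_def x cadlag_fun_to_cadlag[OF f] m_def[symmetric] algebra_simps del: of_nat_Suc)
        moreover have "\<bar>?c * (f t - f s)\<bar> \<le> 1 * (e / 4)"
          unfolding abs_mult using cutoff_bounds[of m t] \<tau>(6)[of t] t False
          by (intro mult_mono) (auto simp: s_def)
        moreover have "\<bar>(?c - ?c') * f s\<bar> \<le> 1 / N * K"
          unfolding abs_mult using cutoff_lipschitz[of m t "\<tau> t"] \<tau>(5)[OF t] K(2)[OF s] N
          by (intro mult_mono) auto
        ultimately have "\<bar>cut (Suc j) (to_cadlag f) t - cut (Suc j) ?x (\<tau> t)\<bar> \<le> e / 4 + 1 / N * K"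
          by linarith
        then show ?thesis unfolding split mult.commute[of K] using Kn by linarith
      qed
    qed
    then show ?case
      using elim(1) e J1_level_nonneg[of "Suc j" "to_cadlag f" ?x]
        J1_level_commute[of "Suc j" ?x "to_cadlag f"]
      unfolding N_def[symmetric] dist_real_def by linarith
  qed
qed

section \<open>Measurability of random paths\<close>

text \<open>
  The discretisations are continuous images of the sampled values, which form a random
  element of a second countable product of real lines. The sequence of paths is their pointwise limit.
\<close>

lemma measurable_to_cadlag_family:
  fixes W :: "nat \<Rightarrow> real \<Rightarrow> 'a \<Rightarrow> real"
  assumes W: "\<And>i u. u \<ge> 0 \<Longrightarrow> W i u \<in> borel_measurable M"
    and cadlag: "\<And>i \<omega>. \<omega> \<in> space M \<Longrightarrow> is_cadlag (\<lambda>u. W i u \<omega>)"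
  shows "(\<lambda>\<omega> i. to_cadlag (\<lambda>u. W i u \<omega>)) \<in> borel_measurable M"
proof (rule borel_measurable_LIMSEQ_metric)
  fix \<omega> assume "\<omega> \<in> space M"
  then show "(\<lambda>n i. to_cadlag (grid_step n (\<lambda>k. W i (real k / real (Suc n)) \<omega>))) \<longlonglongrightarrow> (\<lambda>i. to_cadlag (\<lambda>u. W i u \<omega>))"
    by (intro fun_tendstoI grid_step_tendsto cadlag)
next
  fix n
  have "continuous_on UNIV (\<lambda>v i. to_cadlag (grid_step n (v i)))"
    by (intro continuous_on_coordinatewise_then_product
        continuous_on_compose2[OF continuous_grid_step continuous_on_product_coordinates]) auto
  then have S: "(\<lambda>v i. to_cadlag (grid_step n (v i))) \<in> borel_measurable (borel :: (nat \<Rightarrow> nat \<Rightarrow> real) measure)"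
    by (rule borel_measurable_continuous_onI)
  have "(\<lambda>\<omega> i k. W i (real k / real (Suc n)) \<omega>) \<in> borel_measurable M"
    by (intro measurable_coordinatewise_then_product W) auto
  from measurable_compose[OF this S]
  show "(\<lambda>\<omega> i. to_cadlag (grid_step n (\<lambda>k. W i (real k / real (Suc n)) \<omega>))) \<in> borel_measurable M" .
qed

lemma completion_measurable_AE_cong:
  assumes g: "g \<in> measurable (completion M) N" and eq: "AE \<omega> in M. f \<omega> = g \<omega>"
    and f: "\<And>\<omega>. \<omega> \<in> space M \<Longrightarrow> f \<omega> \<in> space N"
  shows "f \<in> measurable (completion M) N"
proof (rule measurableI)
  fix A assume A: "A \<in> sets N"
  have "g -` A \<inter> space (completion M) \<in> sets (completion M)" by (rule measurable_sets[OF g A])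
  then have sets: "g -` A \<inter> space M \<in> sets (completion M)" by simp
  have ae: "AE \<omega> in completion M. \<omega> \<in> g -` A \<inter> space M \<longleftrightarrow> \<omega> \<in> f -` A \<inter> space M"
    using AE_completion[OF eq] by eventually_elim auto
  show "f -` A \<inter> space (completion M) \<in> sets (completion M)"
    unfolding space_completion by (rule completion.in_sets_AE[OF ae sets]) simp
qed (use f in auto)

lemma mono_rc_zero: "mono_rc (\<lambda>_. 0)"
  by (auto simp: mono_rc_def mono_on_def)

text \<open>
  Replacing the exceptional paths by zero yields a process all of whose paths are nondecreasing and
  right-continuous. It is measurable for the completed \<open>\<sigma>\<close>-algebra, to which the exceptional set
  belongs, and the modification does not affect measurability there.
\<close>

lemma measurable_LS_powers:
  fixes P :: "real \<Rightarrow> 'a \<Rightarrow> real"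
  assumes P: "\<And>s. s \<ge> 0 \<Longrightarrow> P s \<in> borel_measurable M"
    and mono: "AE \<omega> in M. mono_rc (\<lambda>s. P s \<omega>)"
  shows "(\<lambda>\<omega> i. to_cadlag (LS_power (Suc i) (\<lambda>s. P s \<omega>))) \<in> borel_measurable (completion M)"
proof -
  define P' where "P' s \<omega> = (if mono_rc (\<lambda>s. P s \<omega>) then P s \<omega> else 0)" for s \<omega>
  have "Measurable.pred (completion M) (\<lambda>\<omega>. \<not> mono_rc (\<lambda>s. P s \<omega>))"
    by (rule sets_completion_AE) (use mono in simp)
  from measurable_compose[OF this, of Not "count_space UNIV"]
  have [measurable]: "Measurable.pred (completion M) (\<lambda>\<omega>. mono_rc (\<lambda>s. P s \<omega>))" by simp
  have P': "P' s \<in> borel_measurable (completion M)" if "s \<ge> 0" for s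
  proof -
    note [measurable] = measurable_completion[OF P[OF that]]
    show ?thesis unfolding P'_def[abs_def] by measurable
  qed
  have mono': "mono_rc (\<lambda>s. P' s \<omega>)" for \<omega>
    by (cases "mono_rc (\<lambda>s. P s \<omega>)") (simp_all add: P'_def mono_rc_zero)
  have "(\<lambda>\<omega> i. to_cadlag (LS_power (Suc i) (\<lambda>s. P' s \<omega>))) \<in> borel_measurable (completion M)"
    by (intro measurable_to_cadlag_family borel_measurable_LS_power P' mono' is_cadlag_LS_power)
  then show ?thesis
  proof (rule completion_measurable_AE_cong)
    show "AE \<omega> in M. (\<lambda>i. to_cadlag (LS_power (Suc i) (\<lambda>s. P s \<omega>))) = (\<lambda>i. to_cadlag (LS_power (Suc i) (\<lambda>s. P' s \<omega>)))"
      using mono by eventually_elim (simp add: P'_def)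
  qed auto
qed

section \<open>Weak convergence under continuous maps\<close>

text \<open>
  The infimum is the Lipschitz regularisation of \<open>G\<close> (its Pasch-Hausdorff envelope): a \<open>k\<close>-Lipschitz
  function on the whole space that does not exceed \<open>G\<close> on \<open>A\<close>. Truncation at the bound \<open>K\<close> of
  \<open>\<bar>G\<bar>\<close> makes it bounded.
\<close>

definition inf_conv :: "'c::metric_space set \<Rightarrow> ('c \<Rightarrow> real) \<Rightarrow> real \<Rightarrow> real \<Rightarrow> 'c \<Rightarrow> real" where
  "inf_conv A G K k x = min K (INF y\<in>A. G y + k * dist x y)"

context
  fixes A :: "'c::metric_space set" and G :: "'c \<Rightarrow> real" and K :: real
  assumes A: "A \<noteq> {}" and G: "\<And>x. \<bar>G x\<bar> \<le> K"
begin

lemma inf_conv_bdd_below: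
  assumes "k \<ge> 0"
  shows "bdd_below ((\<lambda>y. G y + k * dist x y) ` A)"
proof (rule bdd_belowI2)
  fix y show "- K \<le> G y + k * dist x y" using G[of y] assms by (simp add: add_increasing2 abs_le_iff)
qed

lemma inf_conv_bound:
  assumes "k \<ge> 0"
  shows "\<bar>inf_conv A G K k x\<bar> \<le> K"
proof -
  have "- K \<le> (INF y\<in>A. G y + k * dist x y)"
  proof (rule cINF_greatest[OF A])
    fix y show "- K \<le> G y + k * dist x y" using G[of y] assms by (simp add: add_increasing2 abs_le_iff)
  qed
  moreover have "K \<ge> 0" using G[of undefined] by linarith
  ultimately show ?thesis by (simp add: inf_conv_def abs_le_iff min_le_iff_disj)
qed

lemma inf_conv_le:
  assumes "k \<ge> 0" "x \<in> A"
  shows "inf_conv A G K k x \<le> G x"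
  using cINF_lower[OF inf_conv_bdd_below[OF assms(1)] assms(2), of x] by (simp add: inf_conv_def min_le_iff_disj)

lemma continuous_inf_conv:
  assumes k: "k \<ge> 0"
  shows "continuous_on UNIV (inf_conv A G K k)"
proof -
  let ?g = "\<lambda>x. INF y\<in>A. G y + k * dist x y"
  have le: "?g x - k * dist x x' \<le> ?g x'" for x x'
  proof (rule cINF_greatest[OF A])
    fix y assume y: "y \<in> A"
    have "?g x \<le> G y + k * dist x y"
      by (rule cINF_lower[OF inf_conv_bdd_below[OF k] y])
    also have "\<dots> \<le> G y + k * (dist x x' + dist x' y)"
      using k by (intro add_left_mono mult_left_mono dist_triangle)
    finally show "?g x - k * dist x x' \<le> G y + k * dist x' y" by (simp add: algebra_simps)
  qed
  have "k-lipschitz_on UNIV ?g"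
  proof (rule lipschitz_onI[OF _ k])
    fix x x'
    show "dist (?g x) (?g x') \<le> k * dist x x'"
      using le[of x x'] le[of x' x] by (simp add: dist_real_def abs_le_iff dist_commute algebra_simps)
  qed
  then have "continuous_on UNIV ?g" by (rule lipschitz_on_continuous_on)
  then show ?thesis unfolding inf_conv_def[abs_def] by (intro continuous_intros)
qed

text \<open>
  As \<open>k\<close> grows, the penalty \<open>k * dist z y\<close> excludes all \<open>y\<close> outside a small neighbourhood of \<open>z\<close>, and
  inside it \<open>G y\<close> is close to \<open>G z\<close>.
\<close>

lemma inf_conv_tendsto:
  assumes z: "z \<in> A" and lim: "(G \<longlongrightarrow> G z) (at z within A)"
  shows "(\<lambda>n. inf_conv A G K (real n) z) \<longlonglongrightarrow> G z"
proof (rule tendstoI)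
  fix e :: real assume e: "e > 0"
  have "eventually (\<lambda>y. dist (G y) (G z) < e / 2) (at z within A)"
    using lim e by (intro tendstoD) auto
  then obtain d where d: "d > 0" "\<And>y. y \<in> A \<Longrightarrow> y \<noteq> z \<Longrightarrow> dist y z < d \<Longrightarrow> dist (G y) (G z) < e / 2"
    unfolding eventually_at by blast
  \<comment> \<open>From \<open>n0\<close> on the penalty at distance \<open>d\<close> exceeds the oscillation \<open>2 * K\<close> of \<open>G\<close>.\<close>
  obtain n0 :: nat where n0: "2 * K / d \<le> n0" using real_arch_simple by blast
  show "eventually (\<lambda>n. dist (inf_conv A G K (real n) z) (G z) < e) sequentially"
    using eventually_ge_at_top[of n0]
  proof eventually_elim
    case (elim n)
    have "G z - e / 2 \<le> (INF y\<in>A. G y + real n * dist z y)"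
    proof (rule cINF_greatest[OF A])
      fix y assume y: "y \<in> A"
      show "G z - e / 2 \<le> G y + real n * dist z y"
      proof (cases "dist y z < d")
        case True
        then have "\<bar>G y - G z\<bar> < e / 2" using d(2)[OF y] e by (cases "y = z") (auto simp: dist_real_def)
        moreover have "0 \<le> real n * dist z y" by simp
        ultimately show ?thesis by linarith
      next
        case False
        have "2 * K \<le> real n * d" using n0 elim d(1) by (simp add: pos_divide_le_eq) (smt (verit) mult_right_mono of_nat_mono)
        also have "\<dots> \<le> real n * dist z y" using False by (intro mult_left_mono) (auto simp: dist_commute)
        finally show ?thesis using G[of y] G[of z] e by (simp add: abs_le_iff)
      qed
    qed
    then have "G z - e / 2 \<le> inf_conv A G K (real n) z"
      using G[of z] e by (simp add: inf_conv_def abs_le_iff)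
    then show ?case
      using inf_conv_le[of "real n" z] z e by (simp add: dist_real_def)
  qed
qed

end

text \<open>
  The Lipschitz minorants of \<open>G\<close> are admissible in the definition of weak convergence. Their
  expectations under the limit law increase to that of \<open>G\<close> by dominated convergence, while under
  the approximating laws they stay below that of \<open>G\<close>. The random variables \<open>V\<close> stand for \<open>G\<close> of
  the random elements, with which they need to agree only almost surely.
\<close>

lemma converges_weakly_lower_bound:
  fixes Y :: "'i \<Rightarrow> 'a \<Rightarrow> 'c::metric_space" and G :: "'c \<Rightarrow> real"
  assumes M: "prob_space M" and N: "prob_space N"
    and conv: "converges_weakly M Y N Y' F"
    and G: "\<And>x. \<bar>G x\<bar> \<le> K"
    and V: "eventually (\<lambda>i. V i \<in> borel_measurable (completion M) \<and> (AE \<omega> in M. Y i \<omega> \<in> A \<and> V i \<omega> = G (Y i \<omega>))) F"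
    and V': "V' \<in> borel_measurable (completion N)"
    and Y': "AE \<omega> in N. Y' \<omega> \<in> A \<and> V' \<omega> = G (Y' \<omega>) \<and> (G \<longlongrightarrow> G (Y' \<omega>)) (at (Y' \<omega>) within A)"
    and e: "e > 0"
  shows "eventually (\<lambda>i. (\<integral>\<omega>. V i \<omega> \<partial>completion M) > (\<integral>\<omega>. V' \<omega> \<partial>completion N) - e) F"
proof -
  interpret M: prob_space "completion M" by (rule prob_space.prob_space_completion[OF M])
  interpret N: prob_space "completion N" by (rule prob_space.prob_space_completion[OF N])
  note Y'c = AE_completion[OF Y']
  have "A \<noteq> {}"
  proof
    assume "A = {}"
    then have "AE \<omega> in completion N. False" using Y'c by simp
    then show False using N.AE_False by blast
  qed
  note inf = \<open>A \<noteq> {}\<close> G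
  define h where "h n = inf_conv A G K (real n)" for n :: nat
  have h: "\<bar>h n x\<bar> \<le> K" "continuous_on UNIV (h n)" for n x
    unfolding h_def using inf_conv_bound[OF inf] continuous_inf_conv[OF inf] by auto
  then have h_meas: "h n \<in> borel_measurable borel" for n
    by (intro borel_measurable_continuous_onI)
  have Y'm: "Y' \<in> borel_measurable (completion N)" using conv by (simp add: converges_weakly_def)
  have "(\<lambda>n. \<integral>\<omega>. h n (Y' \<omega>) \<partial>completion N) \<longlonglongrightarrow> (\<integral>\<omega>. V' \<omega> \<partial>completion N)"
  proof (rule integral_dominated_convergence[where w = "\<lambda>_. K"])
    show "(\<lambda>\<omega>. h n (Y' \<omega>)) \<in> borel_measurable (completion N)" for n
      by (rule measurable_compose[OF Y'm h_meas])
    show "AE \<omega> in completion N. (\<lambda>n. h n (Y' \<omega>)) \<longlonglongrightarrow> V' \<omega>"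
      using Y'c unfolding h_def by eventually_elim (auto intro!: inf_conv_tendsto[OF inf])
  qed (use V' h in auto)
  then have "eventually (\<lambda>n. (\<integral>\<omega>. h n (Y' \<omega>) \<partial>completion N) > (\<integral>\<omega>. V' \<omega> \<partial>completion N) - e / 2) sequentially"
    by (rule order_tendstoD) (use e in simp)
  then obtain n where n: "(\<integral>\<omega>. h n (Y' \<omega>) \<partial>completion N) > (\<integral>\<omega>. V' \<omega> \<partial>completion N) - e / 2"
    by (auto simp: eventually_sequentially)
  have "bounded (range (h n))"
    using h(1) by (intro boundedI[where B = K]) auto
  then have "((\<lambda>i. \<integral>\<omega>. h n (Y i \<omega>) \<partial>completion M) \<longlongrightarrow> (\<integral>\<omega>. h n (Y' \<omega>) \<partial>completion N)) F"
    using conv h(2) unfolding converges_weakly_def by blast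
  then have "eventually (\<lambda>i. (\<integral>\<omega>. h n (Y i \<omega>) \<partial>completion M) > (\<integral>\<omega>. h n (Y' \<omega>) \<partial>completion N) - e / 2) F"
    by (rule order_tendstoD) (use e in simp)
  moreover have "eventually (\<lambda>i. Y i \<in> borel_measurable (completion M)) F"
    using conv by (simp add: converges_weakly_def)
  ultimately show ?thesis using V
  proof eventually_elim
    case (elim i)
    have ae: "AE \<omega> in completion M. Y i \<omega> \<in> A \<and> V i \<omega> = G (Y i \<omega>)"
      using elim(3) by (blast intro: AE_completion)
    have "(\<integral>\<omega>. h n (Y i \<omega>) \<partial>completion M) \<le> (\<integral>\<omega>. V i \<omega> \<partial>completion M)"
    proof (rule integral_mono_AE)
      show "integrable (completion M) (\<lambda>\<omega>. h n (Y i \<omega>))"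
        using measurable_compose[OF elim(2) h_meas] h(1)
        by (intro M.integrable_const_bound[where B = K]) auto
      show "integrable (completion M) (V i)"
        using elim(3) ae G by (intro M.integrable_const_bound[where B = K]) (auto elim: eventually_mono)
      show "AE \<omega> in completion M. h n (Y i \<omega>) \<le> V i \<omega>"
        using ae unfolding h_def by eventually_elim (auto intro: inf_conv_le[OF inf])
    qed
    with elim(1) n show ?case by linarith
  qed
qed

text \<open>
  The map \<open>\<Phi>\<close> is required to be continuous only relative to \<open>A\<close> and only at almost all values of the limit. The
  lower bound for \<open>f\<close> and for \<open>- f\<close> composed with \<open>\<Phi>\<close> gives both halves of the convergence.
\<close>

lemma continuous_mapping:
  fixes Y :: "'i \<Rightarrow> 'a \<Rightarrow> 'c::metric_space" and \<Phi> :: "'c \<Rightarrow> 'd::topological_space"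
  assumes M: "prob_space M" and N: "prob_space N"
    and conv: "converges_weakly M Y N Y' F"
    and W: "eventually (\<lambda>i. W i \<in> borel_measurable (completion M) \<and> (AE \<omega> in M. Y i \<omega> \<in> A \<and> W i \<omega> = \<Phi> (Y i \<omega>))) F"
    and W': "W' \<in> borel_measurable (completion N)"
    and Y': "AE \<omega> in N. Y' \<omega> \<in> A \<and> W' \<omega> = \<Phi> (Y' \<omega>) \<and> (\<Phi> \<longlongrightarrow> \<Phi> (Y' \<omega>)) (at (Y' \<omega>) within A)"
  shows "converges_weakly M W N W' F"
  unfolding converges_weakly_def
proof (intro conjI allI impI)
  show "eventually (\<lambda>i. W i \<in> borel_measurable (completion M)) F"
    using W by (auto elim: eventually_mono)
  show "W' \<in> borel_measurable (completion N)" by (rule W')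
  fix f :: "'d \<Rightarrow> real"
  assume f: "continuous_on UNIV f" and "bounded (range f)"
  then obtain K where K: "\<And>x. \<bar>f x\<bar> \<le> K" unfolding bounded_iff by auto
  have lower: "eventually (\<lambda>i. (\<integral>\<omega>. g (W i \<omega>) \<partial>completion M) > (\<integral>\<omega>. g (W' \<omega>) \<partial>completion N) - e) F"
    if g: "continuous_on UNIV g" "\<And>x. \<bar>g x\<bar> \<le> K" and e: "e > 0" for g :: "'d \<Rightarrow> real" and e
  proof (rule converges_weakly_lower_bound[OF M N conv _ _ _ _ e, where G = "\<lambda>x. g (\<Phi> x)" and K = K and A = A])
    note gm = borel_measurable_continuous_onI[OF g(1)]
    show "\<bar>g (\<Phi> x)\<bar> \<le> K" for x by (rule g(2))
    show "eventually (\<lambda>i. (\<lambda>\<omega>. g (W i \<omega>)) \<in> borel_measurable (completion M) \<and>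
        (AE \<omega> in M. Y i \<omega> \<in> A \<and> g (W i \<omega>) = g (\<Phi> (Y i \<omega>)))) F"
      using W by eventually_elim (auto intro: measurable_compose[OF _ gm] elim: eventually_mono)
    show "(\<lambda>\<omega>. g (W' \<omega>)) \<in> borel_measurable (completion N)"
      by (rule measurable_compose[OF W' gm])
    show "AE \<omega> in N. Y' \<omega> \<in> A \<and> g (W' \<omega>) = g (\<Phi> (Y' \<omega>)) \<and>
        ((\<lambda>x. g (\<Phi> x)) \<longlongrightarrow> g (\<Phi> (Y' \<omega>))) (at (Y' \<omega>) within A)"
      using Y' by eventually_elim (auto intro: continuous_on_tendsto_compose[OF g(1)])
  qed
  show "((\<lambda>i. \<integral>\<omega>. f (W i \<omega>) \<partial>completion M) \<longlongrightarrow> (\<integral>\<omega>. f (W' \<omega>) \<partial>completion N)) F"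
  proof (rule tendstoI)
    fix e :: real assume e: "e > 0"
    have "continuous_on UNIV (\<lambda>x. - f x)" by (intro continuous_intros f)
    from lower[OF this _ e] K
    have "eventually (\<lambda>i. (\<integral>\<omega>. - f (W i \<omega>) \<partial>completion M) > (\<integral>\<omega>. - f (W' \<omega>) \<partial>completion N) - e) F"
      by simp
    with lower[OF f K e]
    show "eventually (\<lambda>i. dist (\<integral>\<omega>. f (W i \<omega>) \<partial>completion M) (\<integral>\<omega>. f (W' \<omega>) \<partial>completion N) < e) F"
      by eventually_elim (simp add: dist_real_def abs_less_iff)
  qed
qed

text \<open>
  The truncated distance to \<open>A\<close> is a bounded continuous function that vanishes along the
  approximating sequence, so its expectation under the limit law is 0.
\<close>

lemma converges_weakly_closure:
  fixes Y :: "'i \<Rightarrow> 'a \<Rightarrow> 'c::metric_space"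
  assumes M: "prob_space M" and N: "prob_space N" and F: "F \<noteq> bot"
    and conv: "converges_weakly M Y N Y' F"
    and A: "eventually (\<lambda>i. AE \<omega> in M. Y i \<omega> \<in> A) F"
  shows "AE \<omega> in N. Y' \<omega> \<in> closure A"
proof -
  interpret M: prob_space "completion M" by (rule prob_space.prob_space_completion[OF M])
  interpret N: prob_space "completion N" by (rule prob_space.prob_space_completion[OF N])
  have "A \<noteq> {}"
  proof
    assume "A = {}"
    then have "eventually (\<lambda>i. False) F"
      using A by (auto elim!: eventually_mono simp: prob_space.AE_False[OF M])
    then show False using F by simp
  qed
  define g where "g x = min 1 (infdist x A)" for x
  have g: "continuous_on UNIV g"
    unfolding g_def[abs_def] by (intro continuous_intros)
  have g01: "0 \<le> g x" "g x \<le> 1" for x by (auto simp: g_def infdist_nonneg)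
  have "bounded (range g)" using g01 by (intro boundedI[where B = 1]) auto
  with conv g have lim: "((\<lambda>i. \<integral>\<omega>. g (Y i \<omega>) \<partial>completion M) \<longlongrightarrow> (\<integral>\<omega>. g (Y' \<omega>) \<partial>completion N)) F"
    unfolding converges_weakly_def by blast
  have "eventually (\<lambda>i. (\<integral>\<omega>. g (Y i \<omega>) \<partial>completion M) = 0) F"
    using A
  proof eventually_elim
    case (elim i)
    have "AE \<omega> in completion M. g (Y i \<omega>) = 0"
      using AE_completion[OF elim] by eventually_elim (simp add: g_def)
    then show ?case by (rule integral_eq_zero_AE)
  qed
  then have "((\<lambda>i. \<integral>\<omega>. g (Y i \<omega>) \<partial>completion M) \<longlongrightarrow> 0) F" by (rule tendsto_eventually)
  then have zero: "(\<integral>\<omega>. g (Y' \<omega>) \<partial>completion N) = 0"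
    using lim F by (metis tendsto_unique)
  have Y'm: "Y' \<in> borel_measurable (completion N)" using conv by (simp add: converges_weakly_def)
  have "integrable (completion N) (\<lambda>\<omega>. g (Y' \<omega>))"
    using measurable_compose[OF Y'm borel_measurable_continuous_onI[OF g]] g01
    by (intro N.integrable_const_bound[where B = 1]) auto
  then have "AE \<omega> in completion N. g (Y' \<omega>) = 0"
    using zero g01 by (subst (asm) integral_nonneg_eq_0_iff_AE) auto
  then have "AE \<omega> in completion N. Y' \<omega> \<in> closure A"
    by eventually_elim (use \<open>A \<noteq> {}\<close> in \<open>auto simp: g_def in_closure_iff_infdist_zero min_def split: if_splits\<close>)
  then show ?thesis by (simp add: AE_completion_iff)
qed

section \<open>Convolution powers as a map on the Skorokhod space\<close>

definition mono_paths :: "cadlag set" where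
  "mono_paths = {x. mono_on {0..} (cadlag_fun x)}"

definition conv_powers :: "cadlag \<Rightarrow> nat \<Rightarrow> cadlag" where
  "conv_powers x i = to_cadlag (LS_power (Suc i) (cadlag_fun x))"

lemma mono_rc_mono_paths: "x \<in> mono_paths \<Longrightarrow> mono_rc (cadlag_fun x)"
  using is_cadlag_cadlag_fun[of x] by (simp add: mono_paths_def mono_rc_def is_cadlag_def)

lemma conv_powers_tendsto:
  assumes z: "z \<in> mono_paths" "continuous_on {0..} (cadlag_fun z)"
  shows "(conv_powers \<longlongrightarrow> conv_powers z) (at z within mono_paths)"
  unfolding tendsto_at_iff_sequentially comp_def
proof (intro allI impI)
  fix x :: "nat \<Rightarrow> cadlag"
  assume "\<forall>n. x n \<in> mono_paths - {z}" and lim: "x \<longlonglongrightarrow> z"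
  then have x: "\<And>n. mono_rc (cadlag_fun (x n))" using mono_rc_mono_paths by blast
  note z' = mono_rc_mono_paths[OF z(1)]
  show "(\<lambda>n. conv_powers (x n)) \<longlonglongrightarrow> conv_powers z"
  proof (rule fun_tendstoI)
    fix i
    show "(\<lambda>n. conv_powers (x n) i) \<longlonglongrightarrow> conv_powers z i"
    proof (rule cadlag_tendsto_of_uniform_limit)
      fix T :: real assume "T \<ge> 0"
      then have "uniform_limit {0..T} (\<lambda>n. LS_power (Suc i) (cadlag_fun (x n))) (LS_power (Suc i) (cadlag_fun z)) sequentially"
        by (intro uniform_limit_LS_power x z' z(2) uniform_limit_of_cadlag_tendsto lim)
      then show "uniform_limit {0..T} (\<lambda>n. cadlag_fun (conv_powers (x n) i)) (cadlag_fun (conv_powers z i)) sequentially"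
        by (rule uniform_limit_cong'[THEN iffD1, rotated -1])
          (simp_all add: conv_powers_def cadlag_fun_to_cadlag[OF is_cadlag_LS_power] x z' del: LS_power.simps)
    qed
  qed
qed

text \<open>
  \<open>J\<^sub>1\<close>-convergence to a continuous path entails pointwise convergence, which preserves monotonicity.
\<close>

lemma closure_mono_paths:
  assumes z: "z \<in> closure mono_paths" "continuous_on {0..} (cadlag_fun z)"
  shows "z \<in> mono_paths"
proof -
  obtain x where x: "\<And>n. x n \<in> mono_paths" "x \<longlonglongrightarrow> z"
    using z(1) unfolding closure_sequential by auto
  have lim: "(\<lambda>n. cadlag_fun (x n) t) \<longlonglongrightarrow> cadlag_fun z t" if "t \<ge> 0" for t
    by (rule tendsto_uniform_limitI[OF uniform_limit_of_cadlag_tendsto[OF x(2) z(2), of t]]) (use that in simp)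
  have "cadlag_fun z r \<le> cadlag_fun z s" if "0 \<le> r" "r \<le> s" for r s
  proof (rule LIMSEQ_le[OF lim lim])
    show "\<exists>N. \<forall>n\<ge>N. cadlag_fun (x n) r \<le> cadlag_fun (x n) s"
      using x(1) that by (auto simp: mono_paths_def mono_on_def)
  qed (use that in auto)
  then show ?thesis by (auto simp: mono_paths_def mono_on_def)
qed

lemma continuous_on_imp_is_cadlag:
  assumes f: "continuous_on {0..} f"
  shows "is_cadlag f"
  unfolding is_cadlag_def
proof (intro conjI allI impI)
  fix t :: real assume t: "t \<ge> 0"
  have "(f \<longlongrightarrow> f t) (at t within {0..})" using f t by (auto simp: continuous_on_def)
  then show "continuous (at_right t) f"
    unfolding continuous_within by (rule tendsto_within_subset) (use t in auto)
next
  fix t :: real assume t: "t > 0"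
  have "(f \<longlongrightarrow> f t) (at t within {0..})" using f t by (auto simp: continuous_on_def)
  then have "(f \<longlongrightarrow> f t) (at t)" using t at_within_interior[of t "{0..}"] by simp
  then show "\<exists>l. (f \<longlongrightarrow> l) (at_left t)" by (blast intro: tendsto_within_subset[OF _ subset_UNIV])
qed

lemma to_cadlag_mono_rc:
  assumes "mono_rc g"
  shows "to_cadlag g \<in> mono_paths" and "conv_powers (to_cadlag g) = (\<lambda>i. to_cadlag (LS_power (Suc i) g))"
proof -
  have eq: "cadlag_fun (to_cadlag g) t = g t" if "t \<ge> 0" for t
    using that by (simp add: cadlag_fun_to_cadlag[OF mono_rc_is_cadlag[OF assms]])
  show mp: "to_cadlag g \<in> mono_paths"
    using assms by (auto simp: mono_paths_def mono_on_def eq mono_rc_le)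
  show "conv_powers (to_cadlag g) = (\<lambda>i. to_cadlag (LS_power (Suc i) g))"
    unfolding conv_powers_def[abs_def]
    by (intro ext to_cadlag_cong LS_power_cong assms mono_rc_mono_paths mp eq)
qed

lemma mono_rc_scale:
  assumes g: "mono_rc g" and a: "a > 0" and c: "c > 0"
  shows "mono_rc (\<lambda>s. g (s * a) / c)"
  unfolding mono_rc_def
proof (intro conjI allI impI)
  show "mono_on {0..} (\<lambda>s. g (s * a) / c)"
    using a c by (auto intro!: mono_onI divide_right_mono mono_rc_le[OF g])
  fix t :: real assume t: "t \<ge> 0"
  have "(g \<longlongrightarrow> g (t * a)) (at_right (t * a))"
    using is_cadlag_right_limit[OF mono_rc_is_cadlag[OF g], of "t * a"] t a by simp
  moreover have "filterlim (\<lambda>s. s * a) (at_right (t * a)) (at_right t)"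
    unfolding filterlim_at
    using a by (auto intro!: tendsto_intros simp: eventually_at_filter)
  ultimately have "((\<lambda>s. g (s * a)) \<longlongrightarrow> g (t * a)) (at_right t)"
    by (rule filterlim_compose)
  then show "continuous (at_right t) (\<lambda>s. g (s * a) / c)"
    unfolding continuous_within using c by (intro tendsto_intros) auto
qed

theorem theorem2p2:
  fixes M :: "'a measure" and N :: "'b measure"
    and X :: "real \<Rightarrow> 'a \<Rightarrow> real" and Z :: "real \<Rightarrow> 'b \<Rightarrow> real"
    and c :: "real \<Rightarrow> real"
  assumes "prob_space M" and "prob_space N"
    and "\<And>t. t \<ge> 0 \<Longrightarrow> X t \<in> borel_measurable M"
    and "AE \<omega> in M. mono_on {0..} (\<lambda>t. X t \<omega>) \<and> (\<forall>t\<ge>0. continuous (at_right t) (\<lambda>s. X s \<omega>))"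
    and "\<And>t. t > 0 \<Longrightarrow> c t > 0" and "filterlim c at_top at_top"
    and "\<And>u. u \<ge> 0 \<Longrightarrow> Z u \<in> borel_measurable N"
    and "AE \<omega> in N. continuous_on {0..} (\<lambda>u. Z u \<omega>)"
    and "converges_weakly
           M (\<lambda>t \<omega>. to_cadlag (\<lambda>u. X (u * t) \<omega> / c t))
           N (\<lambda>\<omega>. to_cadlag (\<lambda>u. Z u \<omega>)) at_top"
  shows "converges_weakly
           M (\<lambda>t \<omega> i. to_cadlag (\<lambda>u. LS_power (Suc i) (\<lambda>s. X s \<omega>) (u * t) / c t ^ Suc i))
           N (\<lambda>\<omega> i. to_cadlag (\<lambda>u. LS_power (Suc i) (\<lambda>s. Z s \<omega>) u)) at_top"
proof -
  have X: "AE \<omega> in M. mono_rc (\<lambda>s. X s \<omega>)"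
    using assms(4) by (simp add: mono_rc_def)
  have scaled: "AE \<omega> in M. to_cadlag (\<lambda>u. X (u * t) \<omega> / c t) \<in> mono_paths \<and>
      (\<lambda>i. to_cadlag (\<lambda>u. LS_power (Suc i) (\<lambda>s. X s \<omega>) (u * t) / c t ^ Suc i)) =
        conv_powers (to_cadlag (\<lambda>u. X (u * t) \<omega> / c t))" if t: "t > 0" for t
    using X
  proof eventually_elim
    case (elim \<omega>)
    have m: "mono_rc (\<lambda>u. X (u * t) \<omega> / c t)" by (rule mono_rc_scale[OF elim t assms(5)[OF t]])
    have "(\<lambda>i. to_cadlag (\<lambda>u. LS_power (Suc i) (\<lambda>s. X s \<omega>) (u * t) / c t ^ Suc i)) =
        (\<lambda>i. to_cadlag (LS_power (Suc i) (\<lambda>u. X (u * t) \<omega> / c t)))"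
      using t by (intro ext to_cadlag_cong LS_power_scale[OF elim m, symmetric]) auto
    then show ?case using to_cadlag_mono_rc[OF m] by simp
  qed
  have X_meas: "(\<lambda>\<omega> i. to_cadlag (\<lambda>u. LS_power (Suc i) (\<lambda>s. X s \<omega>) (u * t) / c t ^ Suc i))
      \<in> borel_measurable (completion M)" if t: "t > 0" for t
  proof -
    have m: "AE \<omega> in M. mono_rc (\<lambda>u. X (u * t) \<omega> / c t)"
      using X by eventually_elim (rule mono_rc_scale[OF _ t assms(5)[OF t]])
    have "(\<lambda>\<omega> i. to_cadlag (LS_power (Suc i) (\<lambda>u. X (u * t) \<omega> / c t))) \<in> borel_measurable (completion M)"
      by (rule measurable_LS_powers[OF _ m]) (use t assms(3) in auto)
    then show ?thesis
    proof (rule completion_measurable_AE_cong)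
      show "AE \<omega> in M. (\<lambda>i. to_cadlag (\<lambda>u. LS_power (Suc i) (\<lambda>s. X s \<omega>) (u * t) / c t ^ Suc i)) =
          (\<lambda>i. to_cadlag (LS_power (Suc i) (\<lambda>u. X (u * t) \<omega> / c t)))"
        using scaled[OF t] m by eventually_elim (simp only: to_cadlag_mono_rc)
    qed simp
  qed
  have "AE \<omega> in N. to_cadlag (\<lambda>u. Z u \<omega>) \<in> closure mono_paths"
  proof (rule converges_weakly_closure[OF assms(1,2) _ assms(9)])
    show "eventually (\<lambda>t. AE \<omega> in M. to_cadlag (\<lambda>u. X (u * t) \<omega> / c t) \<in> mono_paths) at_top"
      using eventually_gt_at_top[of 0]
    proof eventually_elim
      case (elim t)
      from scaled[OF this] show ?case by eventually_elim simp
    qed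
  qed simp
  with assms(8) have Z: "AE \<omega> in N. mono_rc (\<lambda>u. Z u \<omega>) \<and> continuous_on {0..} (cadlag_fun (to_cadlag (\<lambda>u. Z u \<omega>)))"
  proof eventually_elim
    case (elim \<omega>)
    have eq: "cadlag_fun (to_cadlag (\<lambda>u. Z u \<omega>)) t = Z t \<omega>" if "t \<ge> 0" for t
      using that by (simp add: cadlag_fun_to_cadlag[OF continuous_on_imp_is_cadlag[OF elim(1)]])
    then have cont: "continuous_on {0..} (cadlag_fun (to_cadlag (\<lambda>u. Z u \<omega>)))"
      using elim(1) eq continuous_on_cong[of "{0..}" "{0..}" "cadlag_fun (to_cadlag (\<lambda>u. Z u \<omega>))" "\<lambda>u. Z u \<omega>"]
      by simp
    have "to_cadlag (\<lambda>u. Z u \<omega>) \<in> mono_paths" by (rule closure_mono_paths[OF elim(2) cont])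
    then have "mono_on {0..} (\<lambda>u. Z u \<omega>)" by (auto simp: mono_paths_def mono_on_def eq)
    then show ?case
      using continuous_on_imp_is_cadlag[OF elim(1)] cont by (simp add: mono_rc_def is_cadlag_def)
  qed
  show ?thesis
  proof (rule continuous_mapping[OF assms(1,2,9), where \<Phi> = conv_powers and A = mono_paths])
    show "eventually (\<lambda>t. (\<lambda>\<omega> i. to_cadlag (\<lambda>u. LS_power (Suc i) (\<lambda>s. X s \<omega>) (u * t) / c t ^ Suc i))
          \<in> borel_measurable (completion M) \<and>
        (AE \<omega> in M. to_cadlag (\<lambda>u. X (u * t) \<omega> / c t) \<in> mono_paths \<and>
          (\<lambda>i. to_cadlag (\<lambda>u. LS_power (Suc i) (\<lambda>s. X s \<omega>) (u * t) / c t ^ Suc i)) =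
          conv_powers (to_cadlag (\<lambda>u. X (u * t) \<omega> / c t)))) at_top"
      using eventually_gt_at_top[of 0] by eventually_elim (intro conjI X_meas scaled)
    have "AE \<omega> in N. mono_rc (\<lambda>u. Z u \<omega>)" using Z by eventually_elim simp
    from measurable_LS_powers[OF assms(7) this]
    show "(\<lambda>\<omega> i. to_cadlag (\<lambda>u. LS_power (Suc i) (\<lambda>s. Z s \<omega>) u)) \<in> borel_measurable (completion N)" .
    show "AE \<omega> in N. to_cadlag (\<lambda>u. Z u \<omega>) \<in> mono_paths \<and>
        (\<lambda>i. to_cadlag (\<lambda>u. LS_power (Suc i) (\<lambda>s. Z s \<omega>) u)) = conv_powers (to_cadlag (\<lambda>u. Z u \<omega>)) \<and>
        (conv_powers \<longlongrightarrow> conv_powers (to_cadlag (\<lambda>u. Z u \<omega>))) (at (to_cadlag (\<lambda>u. Z u \<omega>)) within mono_paths)"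
      using Z
    proof eventually_elim
      case (elim \<omega>)
      note Z_paths = to_cadlag_mono_rc[OF conjunct1[OF elim]]
      show ?case
        by (intro conjI Z_paths(1) Z_paths(2)[symmetric] conv_powers_tendsto conjunct2[OF elim])
    qed
  qed
qed

end
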